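(* Let $\sigma\in\{0,1\}$. If $\mathcal{M}^*,\mathcal{P}^*>0$, let $$\mathcal{E}^*_\sigma=\mathcal{E}_\sigma(\mathcal{M}^*,\mathcal{P}^* )=\inf\left\{\mathcal{E}_\sigma(u):\ u\in W^{\frac14,4}(\mathbb{T}),\ \mathbb{P}_+u=u,\ \mathcal{M}(u)=\mathcal{M}^*,\ \mathcal{P}(u)=\mathcal{P}^*\right\}.$$ Then this infimum is reached at a minimizer. The same holds true if only the momentum or only the mass is fixed (i.e. if only the constraint $\mathcal{P}(u)=\mathcal{P}^*$, or only the constraint $\mathcal{M}(u)=\mathcal{M}^*$, is imposed).
   Context: $\mathbb{T}=\mathbb{R}/(2\pi\mathbb{Z})$; functions are complex valued, with Fourier coefficients $a_k=\frac1{2\pi}\int_0^{2\pi}u(x)e^{-ikx}\,dx$. $\mathbb{P}_+$ is the Fourier projector onto positive frequencies: $\mathbb{P}_+e^{ikx}=\mathbf{1}_{[1,\infty)}(k)e^{ikx}$. $W^{\frac14,4}(\mathbb{T})$ is the fractional Sobolev space of $u\in L^4(\mathbb{T})$ with $\int_0^{2\pi}\!\int_0^{2\pi}\frac{|u(x)-u(y)|^4}{1-\cos(x-y)}\,dx\,dy<\infty$. The energy is $$\mathcal{E}_\sigma(u)=\frac1{4\pi^2}\int_0^{2\pi}\!\!\int_0^{2\pi}\frac{|u(x)-u(y)|^4}{1-\cos(x-y)}\,dx\,dy-\frac{2\sigma}{\pi}\int_0^{2\pi}|u(x)|^4\,dx.$$ The momentum is $\mathcal{P}(u)=\int_0^{2\pi}|u(x)|^2\,dx$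 and the mass is $\mathcal{M}(u)=\int_0^{2\pi}|\partial_x^{-1/2}u|^2\,dx$, where $\partial_x$ is normalized as the Fourier multiplier with symbol $2\pi ik$, so that $\mathcal{M}(u)=\sum_{k\ge1}\frac{|a_k|^2}{k}$ for $u=\sum_{k\ge1}a_ke^{ikx}$.
   Formalization: With both mass and momentum fixed, the claim is stated only when some admissible function exists; since M(u) ≤ P(u)/(2π), there is none when 2πM* > P* (e.g. M* = P* = 1), and then no minimizer can exist. *)

theory Defs
  imports "HOL-Analysis.Analysis"
begin

text \<open>
  Functions on the circle are represented by \<open>2\<pi>\<close>-periodic Borel functions on the real line.
  Elements of Lebesgue spaces are such representatives, not classes, so equality of two elements
  is equality almost everywhere.
\<close>

definition Lp_circle :: "nat \<Rightarrow> (real \<Rightarrow> complex) set" where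
  "Lp_circle p = {u. (\<forall>x. u (x + 2 * pi) = u x) \<and> u \<in> borel_measurable borel \<and>
     set_integrable lborel {0..2*pi} (\<lambda>x. norm (u x) ^ p)}"

definition fourier_coeff :: "(real \<Rightarrow> complex) \<Rightarrow> int \<Rightarrow> complex" where
  "fourier_coeff u k =
     1 / (2 * pi) * (LINT x:{0..2*pi}|lborel. u x * exp (- (\<i> * of_int k * of_real x)))"

text \<open>
  For \<open>u\<close> in \<open>L\<^sup>2\<close> and a bounded symbol \<open>m\<close>, the function chosen here exists (Riesz-Fischer) and is
  unique up to a null set.
\<close>

definition fourier_multiplier :: "(int \<Rightarrow> complex) \<Rightarrow> (real \<Rightarrow> complex) \<Rightarrow> real \<Rightarrow> complex" where
  "fourier_multiplier m u =
     (SOME v. v \<in> Lp_circle 2 \<and> (\<forall>k. fourier_coeff v k = m k * fourier_coeff u k))"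

definition proj_plus :: "(real \<Rightarrow> complex) \<Rightarrow> real \<Rightarrow> complex" where
  "proj_plus = fourier_multiplier (indicator {1..})"

text \<open>
  The square root is the principal branch; the mass depends only on the modulus of the symbol.
  At \<open>k = 0\<close> the symbol is \<open>0 powr (-1/2) = 0\<close>, which is immaterial for functions with only
  positive frequencies.
\<close>

definition deriv_neg_half :: "(real \<Rightarrow> complex) \<Rightarrow> real \<Rightarrow> complex" where
  "deriv_neg_half = fourier_multiplier (\<lambda>k. (2 * of_real pi * \<i> * of_int k) powr (- 1 / 2))"

text \<open>The integrand is \<open>0\<close> by convention where \<open>cos (x - y) = 1\<close>, a null set.\<close>

definition gagliardo :: "(real \<Rightarrow> complex) \<Rightarrow> ennreal" where
  "gagliardo u =
     (\<integral>\<^sup>+x\<in>{0..2*pi}. (\<integral>\<^sup>+y\<in>{0..2*pi}.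
        ennreal (norm (u x - u y) ^ 4 / (1 - cos (x - y))) \<partial>lborel) \<partial>lborel)"

definition W_quarter_4 :: "(real \<Rightarrow> complex) set" where
  "W_quarter_4 = {u \<in> Lp_circle 4. gagliardo u < \<infinity>}"

definition energy :: "real \<Rightarrow> (real \<Rightarrow> complex) \<Rightarrow> real" where
  "energy \<sigma> u = 1 / (4 * pi\<^sup>2) * enn2real (gagliardo u)
     - 2 * \<sigma> / pi * (LINT x:{0..2*pi}|lborel. norm (u x) ^ 4)"

definition momentum :: "(real \<Rightarrow> complex) \<Rightarrow> real" where
  "momentum u = (LINT x:{0..2*pi}|lborel. (norm (u x))\<^sup>2)"

definition mass :: "(real \<Rightarrow> complex) \<Rightarrow> real" where
  "mass u = (LINT x:{0..2*pi}|lborel. (norm (deriv_neg_half u x))\<^sup>2)"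

definition W_plus :: "(real \<Rightarrow> complex) set" where
  "W_plus = {u \<in> W_quarter_4. AE x in lborel. proj_plus u x = u x}"

text \<open>
  The infimum is taken in the extended reals, so that it is a genuine infimum whether or not the
  energy is bounded below on \<open>A\<close>.
\<close>

definition inf_energy :: "real \<Rightarrow> (real \<Rightarrow> complex) set \<Rightarrow> ereal" where
  "inf_energy \<sigma> A = (INF u\<in>A. ereal (energy \<sigma> u))"

definition inf_energy_attained :: "real \<Rightarrow> (real \<Rightarrow> complex) set \<Rightarrow> bool" where
  "inf_energy_attained \<sigma> A \<longleftrightarrow> (\<exists>u\<in>A. ereal (energy \<sigma> u) = inf_energy \<sigma> A)"

end

theory Submission
  imports Defs "HOL-Complex_Analysis.Great_Picard"
begin

text \<open>
  The minimizers are found by the direct method. What makes it work is that, although \<open>1/4 * 4 = 1\<close>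
  is the borderline case for embedding into bounded functions, bounded sets of \<open>W_quarter_4\<close> are
  precompact in \<open>L\<^sup>4\<close>. On an interval of length \<open>l\<close>, the fourth power of the difference of \<open>u x\<close> and
  the mean of \<open>u\<close> is at most \<open>l / 2\<close> times the inner Gagliardo integral at \<open>x\<close>
  (\<open>norm_diff_mean_le\<close>). So a bounded sequence whose means over all cells of all grids converge is
  Cauchy in \<open>L\<^sup>4\<close>, and a diagonal argument provides such a subsequence
  (\<open>L4_Cauchy_subsequence\<close>).

  Along an \<open>L\<^sup>4\<close>-convergent subsequence the momentum and the quartic term of the energy converge, the
  Gagliardo integral is lower semicontinuous by Fatou's lemma, and each Fourier coefficient
  converges. The restriction to positive frequencies therefore survives, because \<open>u\<close> is its own
  projection exactly when its coefficients of index at most \<open>0\<close> vanish (\<open>W_plus_iff\<close>). The mass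
  converges too, being by Parseval a weighted sum of squares of coefficients dominated by the
  momentum. Together this is \<open>W_plus_compact\<close>. As projection and mass are given by Fourier
  multipliers, that is, by a choice of a function with prescribed coefficients, they say something
  about \<open>u\<close> only through the Riesz-Fischer theorem (such a function exists) and the uniqueness of
  Fourier coefficients (it is determined almost everywhere).

  It remains to bound \<open>L\<^sup>4\<close> norms and Gagliardo integrals along a minimizing sequence, even for
  \<open>\<sigma> = 1\<close>, when the quartic term of the energy is of the same degree as the Gagliardo integral and
  has the opposite sign. Here the constraint enters: by compactness once more, a sequence of bounded mass and energy whose \<open>L\<^sup>4\<close> norms blow up would, after
  normalization, converge to a function of positive frequencies with mass zero and \<open>L\<^sup>4\<close> norm one,
  which is absurd (\<open>energy_coercive\<close>). The mass is at most the momentum, so a bound on either of them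
  suffices and the three variational problems are instances of one statement,
  \<open>inf_energy_attainedI\<close>. Multiples of the first harmonic show that the two problems with a single
  constraint have competitors.
\<close>

section \<open>Dominated almost-everywhere subsequences in \<open>L\<^sup>p\<close>\<close>

lemma power_add_le_two_power:
  fixes a b :: real
  assumes "0 \<le> a" "0 \<le> b"
  shows "(a + b) ^ p \<le> 2 ^ p * (a ^ p + b ^ p)"
proof -
  have "(a + b) ^ p \<le> (2 * max a b) ^ p"
    using assms by (intro power_mono) auto
  also have "\<dots> = 2 ^ p * (max a b) ^ p" by (simp add: power_mult_distrib)
  also have "(max a b) ^ p \<le> a ^ p + b ^ p"
    using assms by (auto simp: max_def)
  finally show ?thesis by simp
qed

lemma norm_diff_power_le:
  fixes a b :: "'a::real_normed_vector"
  shows "norm (a - b) ^ p \<le> 2 ^ p * (norm a ^ p + norm b ^ p)"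
  by (rule order_trans[OF power_mono[OF norm_triangle_ineq4] power_add_le_two_power]) auto

lemma norm_add_power_le:
  fixes a b :: "'a::real_normed_vector"
  shows "norm (a + b) ^ p \<le> 2 ^ p * (norm a ^ p + norm b ^ p)"
  using norm_diff_power_le[of a "-b" p] by simp

lemma integrable_norm_diff_power:
  fixes f g :: "'a \<Rightarrow> complex"
  assumes [measurable]: "f \<in> borel_measurable M" "g \<in> borel_measurable M"
    and f: "integrable M (\<lambda>x. norm (f x) ^ p)" and g: "integrable M (\<lambda>x. norm (g x) ^ p)"
  shows "integrable M (\<lambda>x. norm (f x - g x) ^ p)"
proof (rule Bochner_Integration.integrable_bound)
  show "integrable M (\<lambda>x. 2 ^ p * (norm (f x) ^ p + norm (g x) ^ p))"
    using f g by simp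
qed (use norm_diff_power_le in \<open>auto simp: abs_mult intro!: AE_I2\<close>)

text \<open>
  The selection of a rapidly Cauchy subsequence. The increments are measured by an arbitrary \<open>d\<close>,
  as in the application they are \<open>p\<close>-th powers of \<open>L\<^sup>p\<close> distances.
\<close>

lemma subseq_small_steps:
  fixes d :: "nat \<Rightarrow> nat \<Rightarrow> real" and e :: "nat \<Rightarrow> real"
  assumes cauchy: "\<And>e. e > 0 \<Longrightarrow> \<exists>N. \<forall>m\<ge>N. \<forall>n\<ge>N. d m n < e"
    and e: "\<And>k. e k > 0"
  obtains r where "strict_mono r" "\<And>k. d (r (Suc k)) (r k) < e k"
proof -
  have "\<forall>k. \<exists>N. \<forall>m\<ge>N. \<forall>n\<ge>N. d m n < e k" using cauchy e by blast
  then obtain N where N: "\<And>k m n. m \<ge> N k \<Longrightarrow> n \<ge> N k \<Longrightarrow> d m n < e k" by metis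
  define r where "r = rec_nat (N 0) (\<lambda>k s. max (Suc s) (N (Suc k)))"
  have rS: "r (Suc k) = max (Suc (r k)) (N (Suc k))" and r0: "r 0 = N 0" for k
    by (simp_all add: r_def)
  have ge: "r k \<ge> N k" for k by (cases k) (auto simp: rS r0)
  have "strict_mono r" by (auto simp: strict_mono_Suc_iff rS)
  moreover have "d (r (Suc k)) (r k) < e k" for k
    using ge[of k] by (intro N) (auto simp: rS)
  ultimately show ?thesis using that by blast
qed

text \<open>
  If the increments of the subsequence are so small that their \<open>p\<close>-th powers stay summable in
  \<open>L\<^sup>1\<close> after weighting by \<open>2 ^ (k * p)\<close>, then pointwise they are at most \<open>(1/2) ^ k\<close> times a single
  \<open>L\<^sup>p\<close> function, and a geometric series gives both convergence and a dominating function.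
  Domination is what later lets every limit be taken by dominated convergence, for all exponents
  up to \<open>p\<close> at once.
\<close>

lemma Lp_Cauchy_dominated_subseq:
  fixes f :: "nat \<Rightarrow> 'a \<Rightarrow> complex"
  assumes meas[measurable]: "\<And>n. f n \<in> borel_measurable M"
    and int: "\<And>n. integrable M (\<lambda>x. norm (f n x) ^ p)"
    and p: "p > 0"
    and cauchy: "\<And>e. e > 0 \<Longrightarrow> \<exists>N. \<forall>m\<ge>N. \<forall>n\<ge>N. (\<integral>x. norm (f m x - f n x) ^ p \<partial>M) < e"
  obtains r H where "strict_mono r" "H \<in> borel_measurable M" "integrable M (\<lambda>x. H x ^ p)"
    "AE x in M. (\<forall>k. norm (f (r k) x) \<le> H x) \<and> convergent (\<lambda>k. f (r k) x)"
proof -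
  obtain r where r: "strict_mono r"
    and small: "\<And>k. (\<integral>x. norm (f (r (Suc k)) x - f (r k) x) ^ p \<partial>M) < (1/2) ^ k / 2 ^ (k * p)"
    by (rule subseq_small_steps[of "\<lambda>m n. \<integral>x. norm (f m x - f n x) ^ p \<partial>M"
        "\<lambda>k. (1/2) ^ k / 2 ^ (k * p)", OF cauchy]) auto
  define d where "d = (\<lambda>k x. norm (f (r (Suc k)) x - f (r k) x))"
  have [measurable]: "d k \<in> borel_measurable M" for k by (simp add: d_def)
  define t where "t = (\<lambda>k x. 2 ^ (k * p) * d k x ^ p)"
  have [measurable]: "t k \<in> borel_measurable M" for k by (simp add: t_def)
  have t0: "t k x \<ge> 0" for k x by (simp add: t_def d_def)
  have dint: "integrable M (\<lambda>x. d k x ^ p)" for k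
    unfolding d_def by (intro integrable_norm_diff_power int meas)
  have tint: "integrable M (t k)" for k
    unfolding t_def using dint by simp
  have tsmall: "(\<integral>x. t k x \<partial>M) \<le> (1/2) ^ k" for k
    using small[of k] by (simp add: t_def d_def field_simps)
  have nnt: "(\<integral>\<^sup>+x. ennreal (t k x) \<partial>M) \<le> ennreal ((1/2) ^ k)" for k
    using tint[of k] t0 tsmall[of k] by (simp add: nn_integral_eq_integral ennreal_leI)
  have total: "(\<integral>\<^sup>+x. (\<Sum>k. ennreal (t k x)) \<partial>M) \<le> ennreal 2"
  proof -
    have "(\<integral>\<^sup>+x. (\<Sum>k. ennreal (t k x)) \<partial>M) = (\<Sum>k. \<integral>\<^sup>+x. ennreal (t k x) \<partial>M)"
      by (rule nn_integral_suminf) simp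
    also have "\<dots> \<le> (\<Sum>k. ennreal ((1/2) ^ k))"
      by (intro suminf_le nnt) auto
    also have "\<dots> = ennreal (\<Sum>k. (1/2) ^ k)"
      by (intro suminf_ennreal2) (auto intro: summable_geometric)
    also have "(\<Sum>k. (1/2::real) ^ k) = 2" by (simp add: suminf_geometric)
    finally show ?thesis .
  qed
  define S where "S = (\<lambda>x. \<Sum>k. t k x)"
  have [measurable]: "S \<in> borel_measurable M" unfolding S_def by measurable
  have fin: "AE x in M. (\<Sum>k. ennreal (t k x)) \<noteq> \<infinity>"
    using total by (intro nn_integral_noteq_infinite) (auto simp: top_unique)
  have summ: "AE x in M. summable (\<lambda>k. t k x)"
    using fin by eventually_elim (auto intro!: summable_suminf_not_top t0)
  have Sint: "integrable M S"
  proof (rule integrableI_bounded)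
    have "(\<integral>\<^sup>+x. ennreal (norm (S x)) \<partial>M) = (\<integral>\<^sup>+x. (\<Sum>k. ennreal (t k x)) \<partial>M)"
      using summ
      by (intro nn_integral_cong_AE)
        (auto elim!: eventually_mono simp: S_def suminf_ennreal2 t0 suminf_nonneg)
    also have "\<dots> < \<infinity>" using total by (simp add: le_less_trans ennreal_less_top)
    finally show "(\<integral>\<^sup>+x. ennreal (norm (S x)) \<partial>M) < \<infinity>" .
  qed simp
  define H where "H = (\<lambda>x. norm (f (r 0) x) + 2 * root p \<bar>S x\<bar>)"
  have [measurable]: "H \<in> borel_measurable M" unfolding H_def by measurable
  have root_pow: "root p \<bar>S x\<bar> ^ p = \<bar>S x\<bar>" for x using p by simp
  have Hint: "integrable M (\<lambda>x. H x ^ p)"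
  proof (rule Bochner_Integration.integrable_bound)
    show "integrable M (\<lambda>x. 2 ^ p * (norm (f (r 0) x) ^ p + 2 ^ p * S x))"
      using int Sint by simp
    show "AE x in M. norm (H x ^ p) \<le> norm (2 ^ p * (norm (f (r 0) x) ^ p + 2 ^ p * S x))"
      using summ
    proof eventually_elim
      fix x assume "summable (\<lambda>k. t k x)"
      then have S0: "S x \<ge> 0" unfolding S_def by (intro suminf_nonneg t0)
      have "H x ^ p \<le> 2 ^ p * (norm (f (r 0) x) ^ p + (2 * root p \<bar>S x\<bar>) ^ p)"
        unfolding H_def using p by (intro power_add_le_two_power) auto
      also have "(2 * root p \<bar>S x\<bar>) ^ p = 2 ^ p * S x"
        using root_pow[of x] S0 by (simp add: power_mult_distrib)
      finally show "norm (H x ^ p) \<le> norm (2 ^ p * (norm (f (r 0) x) ^ p + 2 ^ p * S x))"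
        using S0 p by (simp add: H_def)
    qed
  qed simp
  have AE: "AE x in M. (\<forall>k. norm (f (r k) x) \<le> H x) \<and> convergent (\<lambda>k. f (r k) x)"
    using summ
  proof eventually_elim
    fix x assume sx: "summable (\<lambda>k. t k x)"
    then have S0: "S x \<ge> 0" unfolding S_def by (intro suminf_nonneg t0)
    have dle: "d k x \<le> root p (S x) * (1/2) ^ k" for k
    proof -
      have "t k x \<le> S x"
        unfolding S_def using sum_le_suminf[OF sx, of "{k}"] t0 by auto
      then have "(2 ^ k * d k x) ^ p \<le> root p (S x) ^ p"
        using root_pow[of x] S0 by (simp add: t_def power_mult_distrib power_mult)
      then have "2 ^ k * d k x \<le> root p (S x)"
        using p S0 by (subst (asm) power_mono_iff) (auto simp: d_def)
      then show ?thesis by (simp add: field_simps)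
    qed
    have geo: "(\<lambda>k. root p (S x) * (1/2) ^ k) sums (root p (S x) * 2)"
      using geometric_sums[of "1/2::real"] by (intro sums_mult) auto
    have ds: "summable (\<lambda>k. f (r (Suc k)) x - f (r k) x)"
      using dle geo by (intro summable_comparison_test[OF _ sums_summable[OF geo]])
        (auto simp: d_def)
    have tel: "f (r k) x = f (r 0) x + (\<Sum>j<k. f (r (Suc j)) x - f (r j) x)" for k
      by (simp add: sum_lessThan_telescope[of "\<lambda>j. f (r j) x"])
    have "norm (f (r k) x) \<le> H x" for k
    proof -
      have "norm (f (r k) x) \<le> norm (f (r 0) x) + (\<Sum>j<k. d j x)"
        unfolding d_def by (subst tel) (rule order_trans[OF norm_triangle_ineq add_left_mono[OF norm_sum]])
      also have "(\<Sum>j<k. d j x) \<le> (\<Sum>j<k. root p (S x) * (1/2) ^ j)"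
        by (intro sum_mono dle)
      also have "\<dots> \<le> root p (S x) * 2"
        using S0 p by (subst sums_unique[OF geo], intro sum_le_suminf sums_summable[OF geo]) auto
      finally show ?thesis using S0 by (simp add: H_def)
    qed
    moreover have "convergent (\<lambda>k. f (r k) x)"
      by (subst tel) (use ds in \<open>auto intro!: convergent_add simp: convergent_const summable_iff_convergent\<close>)
    ultimately show "(\<forall>k. norm (f (r k) x) \<le> H x) \<and> convergent (\<lambda>k. f (r k) x)" by blast
  qed
  show ?thesis using that[OF r _ Hint AE] by simp
qed

section \<open>Lebesgue spaces on the circle\<close>

text \<open>
  The measure carries a whole closed period, endpoints included, to agree with the integrals in
  the definitions of the norms and coefficients; the doubled endpoint is a null set.
\<close>

definition circ :: "real measure" where
  "circ = restrict_space lborel {0..2 * pi}"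

lemma space_circ [simp]: "space circ = {0..2 * pi}"
  by (simp add: circ_def space_restrict_space)

lemma sets_circ [measurable_cong]: "sets circ = sets (restrict_space borel {0..2 * pi})"
  by (simp add: circ_def sets_restrict_space)

lemma borel_measurable_circ: "f \<in> borel_measurable borel \<Longrightarrow> f \<in> measurable circ borel"
  unfolding circ_def by (intro measurable_restrict_space1) simp

lemma id_measurable_circ [measurable]: "(\<lambda>x. x) \<in> measurable circ borel"
  by (intro borel_measurable_circ) simp

lemma emeasure_circ [simp]: "emeasure circ {0..2 * pi} = ennreal (2 * pi)"
  by (simp add: circ_def emeasure_restrict_space)

interpretation circ: finite_measure circ
  by (rule finite_measureI) simp

lemma measure_circ [simp]: "measure circ {0..2 * pi} = 2 * pi"
  by (simp add: measure_def)

lemma integral_circ: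
  fixes f :: "real \<Rightarrow> 'b::{banach, second_countable_topology}"
  shows "(LINT x:{0..2*pi}|lborel. f x) = (\<integral>x. f x \<partial>circ)"
  unfolding circ_def set_lebesgue_integral_def by (subst integral_restrict_space) auto

lemma set_integrable_circ:
  fixes f :: "real \<Rightarrow> 'b::{banach, second_countable_topology}"
  shows "set_integrable lborel {0..2*pi} f \<longleftrightarrow> integrable circ f"
  unfolding circ_def set_integrable_def by (subst integrable_restrict_space) auto

lemma nn_integral_circ: "(\<integral>\<^sup>+x\<in>{0..2*pi}. f x \<partial>lborel) = (\<integral>\<^sup>+x. f x \<partial>circ)"
  unfolding circ_def by (subst nn_integral_restrict_space) auto

lemma AE_circ: "(AE x in lborel. P x) \<Longrightarrow> (AE x in circ. P x)"
  unfolding circ_def by (subst AE_restrict_space_iff) (auto elim: eventually_mono)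

lemma Lp_circle_iff:
  "u \<in> Lp_circle p \<longleftrightarrow> (\<forall>x. u (x + 2 * pi) = u x) \<and> u \<in> borel_measurable borel \<and>
     integrable circ (\<lambda>x. norm (u x) ^ p)"
  by (simp add: Lp_circle_def set_integrable_circ)

lemma Lp_circle_periodic: "u \<in> Lp_circle p \<Longrightarrow> u (x + 2 * pi) = u x"
  and Lp_circle_borel: "u \<in> Lp_circle p \<Longrightarrow> u \<in> borel_measurable borel"
  and Lp_circle_integrable: "u \<in> Lp_circle p \<Longrightarrow> integrable circ (\<lambda>x. norm (u x) ^ p)"
  by (auto simp: Lp_circle_iff)

lemma power_le_one_add_power:
  fixes a :: real
  assumes "0 \<le> a" "p \<le> q"
  shows "a ^ p \<le> 1 + a ^ q"
proof (cases "a \<le> 1")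
  case True
  then show ?thesis using assms by (simp add: add_increasing2 power_le_one)
next
  case False
  then have "a ^ p \<le> a ^ q" by (intro power_increasing \<open>p \<le> q\<close>) simp
  then show ?thesis by simp
qed

lemma integrable_circ_power_mono:
  fixes f :: "real \<Rightarrow> 'b::{banach, second_countable_topology}"
  assumes [measurable]: "f \<in> borel_measurable circ"
    and "integrable circ (\<lambda>x. norm (f x) ^ q)" "p \<le> q"
  shows "integrable circ (\<lambda>x. norm (f x) ^ p)"
proof (rule Bochner_Integration.integrable_bound)
  show "integrable circ (\<lambda>x. 1 + norm (f x) ^ q)"
    using assms by simp
qed (use power_le_one_add_power[OF norm_ge_zero \<open>p \<le> q\<close>] in \<open>auto intro!: AE_I2 simp: abs_of_nonneg\<close>)

lemma Lp_circle_mono: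
  assumes "u \<in> Lp_circle q" "p \<le> q"
  shows "u \<in> Lp_circle p"
  using assms integrable_circ_power_mono[of u q p]
  by (auto simp: Lp_circle_iff borel_measurable_circ)

lemma Lp_circle_integrable_self:
  assumes "u \<in> Lp_circle p" "p > 0"
  shows "integrable circ u"
  using Lp_circle_mono[OF assms(1), of 1] assms(2)
  by (subst integrable_norm_iff[symmetric]) (auto simp: Lp_circle_iff borel_measurable_circ)

lemma Lp_circle_diff:
  assumes "u \<in> Lp_circle p" "v \<in> Lp_circle p"
  shows "(\<lambda>x. u x - v x) \<in> Lp_circle p"
  using assms by (auto simp: Lp_circle_iff intro!: integrable_norm_diff_power borel_measurable_circ)

lemma Lp_circle_cmult:
  assumes "u \<in> Lp_circle p"
  shows "(\<lambda>x. c * u x) \<in> Lp_circle p"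
  using assms by (auto simp: Lp_circle_iff norm_mult power_mult_distrib)

lemma Lp_circle_bounded:
  assumes "\<And>x. u (x + 2 * pi) = u x" "u \<in> borel_measurable borel" "\<And>x. norm (u x) \<le> B"
  shows "u \<in> Lp_circle p"
proof -
  have [measurable]: "u \<in> borel_measurable borel" by fact
  have "integrable circ (\<lambda>x. norm (u x) ^ p)"
    by (intro circ.integrable_const_bound[where B="B ^ p"]) (auto intro!: AE_I2 power_mono assms(3))
  then show ?thesis using assms by (simp add: Lp_circle_iff)
qed

section \<open>Fourier coefficients\<close>

definition expi :: "int \<Rightarrow> real \<Rightarrow> complex" where
  "expi k x = cis (of_int k * x)"

lemma expi_measurable [measurable]: "expi k \<in> borel_measurable borel"
  unfolding expi_def cis_conv_exp by measurable

lemma norm_expi [simp]: "norm (expi k x) = 1"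
  by (simp add: expi_def)

lemma expi_mult: "expi j x * expi k x = expi (j + k) x"
  by (simp add: expi_def cis_mult algebra_simps)

lemma cnj_expi: "cnj (expi k x) = expi (-k) x"
  by (simp add: expi_def cis_cnj)

lemma expi_0 [simp]: "expi 0 x = 1"
  by (simp add: expi_def)

lemma expi_periodic: "expi k (x + 2 * pi) = expi k x"
proof -
  have "expi k (x + 2 * pi) = expi k x * cis (2 * pi * of_int k)"
    by (simp add: expi_def cis_mult algebra_simps)
  also have "cis (2 * pi * of_int k) = 1"
    by (rule cis_multiple_2pi) auto
  finally show ?thesis by simp
qed

lemma expi_Lp: "expi k \<in> Lp_circle p"
  by (rule Lp_circle_bounded[where B=1]) (auto simp: expi_periodic)

lemma integrable_mult_expi:
  assumes "integrable circ u"
  shows "integrable circ (\<lambda>x. u x * expi k x)"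
  using assms by (subst integrable_norm_iff[symmetric]) (auto simp: norm_mult)

lemma fourier_coeff_circ: "fourier_coeff u k = (\<integral>x. u x * expi (-k) x \<partial>circ) / (2 * pi)"
  unfolding fourier_coeff_def integral_circ by (simp add: expi_def cis_conv_exp mult.assoc)

lemma integral_expi: "(\<integral>x. expi k x \<partial>circ) = (if k = 0 then 2 * pi else 0)"
proof (cases "k = 0")
  case True
  then show ?thesis by (simp add: scaleR_conv_of_real)
next
  case False
  define F where "F = (\<lambda>x::real. expi k x / (\<i> * of_int k))"
  have "(\<integral>x. indicator {0..2*pi} x *\<^sub>R expi k x \<partial>lborel) = F (2 * pi) - F 0"
  proof (rule integral_FTC_atLeastAtMost)
    fix x :: real
    show "(F has_vector_derivative expi k x) (at x within {0..2 * pi})"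
    proof -
      have "((\<lambda>z. exp (\<i> * of_int k * z) / (\<i> * of_int k)) has_field_derivative
          exp (\<i> * of_int k * of_real x)) (at (of_real x))"
        using False by (auto intro!: derivative_eq_intros)
      from has_vector_derivative_real_field[OF this, of "{0..2*pi}"] show ?thesis
        by (simp add: F_def expi_def cis_conv_exp mult.assoc)
    qed
    show "continuous_on {0..2 * pi} (expi k)"
      unfolding expi_def by (auto intro!: continuous_intros)
  qed simp
  also have "\<dots> = 0" using expi_periodic[of k 0] by (simp add: F_def)
  finally show ?thesis using False integral_circ[of "expi k"] by (simp add: set_lebesgue_integral_def)
qed

lemma fourier_coeff_diff:
  assumes "integrable circ u" "integrable circ v"
  shows "fourier_coeff (\<lambda>x. u x - v x) k = fourier_coeff u k - fourier_coeff v k"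
  using assms by (simp add: fourier_coeff_circ left_diff_distrib integrable_mult_expi diff_divide_distrib)

lemma fourier_coeff_cmult: "fourier_coeff (\<lambda>x. c * u x) k = c * fourier_coeff u k"
  by (simp add: fourier_coeff_circ mult.assoc)

lemma fourier_coeff_sum:
  assumes "\<And>i. i \<in> I \<Longrightarrow> integrable circ (u i)"
  shows "fourier_coeff (\<lambda>x. \<Sum>i\<in>I. u i x) k = (\<Sum>i\<in>I. fourier_coeff (u i) k)"
  using assms by (simp add: fourier_coeff_circ sum_distrib_right integrable_mult_expi sum_divide_distrib)

lemma fourier_coeff_expi: "fourier_coeff (expi j) k = (if j = k then 1 else 0)"
  by (auto simp: fourier_coeff_circ expi_mult integral_expi)

lemma norm_fourier_coeff_le:
  assumes "integrable circ u"
  shows "norm (fourier_coeff u k) \<le> (\<integral>x. norm (u x) \<partial>circ) / (2 * pi)"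
proof -
  have "norm (\<integral>x. u x * expi (-k) x \<partial>circ) \<le> (\<integral>x. norm (u x * expi (-k) x) \<partial>circ)"
    by (rule integral_norm_bound)
  then show ?thesis
    by (simp add: fourier_coeff_circ norm_divide norm_mult divide_right_mono)
qed

section \<open>Completeness and the Riesz-Fischer theorem\<close>

lemma fourier_coeff_tendsto:
  fixes u :: "nat \<Rightarrow> real \<Rightarrow> complex"
  assumes "\<And>n. integrable circ (u n)" "integrable circ v"
    and "(\<lambda>n. \<integral>x. norm (u n x - v x) \<partial>circ) \<longlonglongrightarrow> 0"
  shows "(\<lambda>n. fourier_coeff (u n) k) \<longlonglongrightarrow> fourier_coeff v k"
proof (rule LIM_zero_cancel, rule Lim_null_comparison)
  show "\<forall>\<^sub>F n in sequentially. norm (fourier_coeff (u n) k - fourier_coeff v k)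
      \<le> (\<integral>x. norm (u n x - v x) \<partial>circ) / (2 * pi)"
    using norm_fourier_coeff_le[of "\<lambda>x. u n x - v x" k for n] assms(1,2)
    by (simp add: fourier_coeff_diff)
  show "(\<lambda>n. (\<integral>x. norm (u n x - v x) \<partial>circ) / (2 * pi)) \<longlonglongrightarrow> 0"
    using tendsto_divide[OF assms(3) tendsto_const[of "2 * pi"]] by simp
qed

text \<open>
  The limit is defined everywhere as a pointwise limit, so it inherits periodicity from the sequence
  at every point, including those where the sequence diverges and \<open>lim\<close> is a default value.
\<close>

lemma Lp_circle_complete:
  fixes u :: "nat \<Rightarrow> real \<Rightarrow> complex"
  assumes u: "\<And>n. u n \<in> Lp_circle p" and p: "p > 0"
    and cauchy: "\<And>e. e > 0 \<Longrightarrow> \<exists>N. \<forall>m\<ge>N. \<forall>n\<ge>N. (\<integral>x. norm (u m x - u n x) ^ p \<partial>circ) < e"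
  obtains r v where "strict_mono r" "v \<in> Lp_circle p"
    "AE x in circ. (\<lambda>k. u (r k) x) \<longlonglongrightarrow> v x"
    "\<And>q. q \<le> p \<Longrightarrow> (\<lambda>k. \<integral>x. norm (u (r k) x) ^ q \<partial>circ) \<longlonglongrightarrow> (\<integral>x. norm (v x) ^ q \<partial>circ)"
    "\<And>q. 0 < q \<Longrightarrow> q \<le> p \<Longrightarrow> (\<lambda>k. \<integral>x. norm (u (r k) x - v x) ^ q \<partial>circ) \<longlonglongrightarrow> 0"
    "\<And>j. (\<lambda>k. fourier_coeff (u (r k)) j) \<longlonglongrightarrow> fourier_coeff v j"
proof -
  have [measurable]: "u n \<in> borel_measurable borel" for n
    using u by (rule Lp_circle_borel)
  have uint: "integrable circ (\<lambda>x. norm (u n x) ^ p)" for n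
    using u by (rule Lp_circle_integrable)
  obtain r H where r: "strict_mono r" and [measurable]: "H \<in> borel_measurable circ"
    and Hint: "integrable circ (\<lambda>x. H x ^ p)"
    and AE: "AE x in circ. (\<forall>k. norm (u (r k) x) \<le> H x) \<and> convergent (\<lambda>k. u (r k) x)"
    by (rule Lp_Cauchy_dominated_subseq[of u circ p, OF _ uint p cauchy]) auto
  define v where "v = (\<lambda>x. lim (\<lambda>k. u (r k) x))"
  have [measurable]: "v \<in> borel_measurable borel" unfolding v_def by measurable
  have lim: "AE x in circ. (\<lambda>k. u (r k) x) \<longlonglongrightarrow> v x"
    using AE by eventually_elim (auto simp: v_def convergent_LIMSEQ_iff)
  have bound: "AE x in circ. norm (v x) \<le> H x"
    using AE lim
  proof eventually_elim
    fix x assume "(\<forall>k. norm (u (r k) x) \<le> H x) \<and> convergent (\<lambda>k. u (r k) x)"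
      and l: "(\<lambda>k. u (r k) x) \<longlonglongrightarrow> v x"
    then show "norm (v x) \<le> H x"
      by (intro LIMSEQ_le_const2[OF tendsto_norm[OF l]]) auto
  qed
  have H0: "AE x in circ. 0 \<le> H x"
    using bound by eventually_elim (use norm_ge_zero order_trans in blast)
  have Hq: "integrable circ (\<lambda>x. \<bar>H x\<bar> ^ q)" if "q \<le> p" for q
  proof -
    have "integrable circ (\<lambda>x. norm (H x) ^ p)"
      using Hint H0 by (subst integrable_cong_AE[where g="\<lambda>x. H x ^ p"]) (auto elim!: eventually_mono)
    from integrable_circ_power_mono[OF _ this that] show ?thesis by simp
  qed
  have "integrable circ (\<lambda>x. norm (v x) ^ p)"
  proof (rule Bochner_Integration.integrable_bound[OF Hq[of p]])
    show "AE x in circ. norm (norm (v x) ^ p) \<le> norm (\<bar>H x\<bar> ^ p)"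
      using bound by eventually_elim (auto intro!: power_mono)
  qed auto
  moreover have "v (x + 2 * pi) = v x" for x
    by (simp add: v_def Lp_circle_periodic[OF u])
  ultimately have v: "v \<in> Lp_circle p" by (simp add: Lp_circle_iff)
  have norms: "(\<lambda>k. \<integral>x. norm (u (r k) x) ^ q \<partial>circ) \<longlonglongrightarrow> (\<integral>x. norm (v x) ^ q \<partial>circ)"
    if "q \<le> p" for q
  proof (rule integral_dominated_convergence[OF _ _ Hq[OF that]])
    show "AE x in circ. (\<lambda>k. norm (u (r k) x) ^ q) \<longlonglongrightarrow> norm (v x) ^ q"
      using lim by eventually_elim (intro tendsto_intros)
    show "AE x in circ. norm (norm (u (r k) x) ^ q) \<le> \<bar>H x\<bar> ^ q" for k
      using AE H0 by eventually_elim (auto intro!: power_mono)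
  qed auto
  have diffs: "(\<lambda>k. \<integral>x. norm (u (r k) x - v x) ^ q \<partial>circ) \<longlonglongrightarrow> 0"
    if "0 < q" "q \<le> p" for q
  proof -
    have "(\<lambda>k. \<integral>x. norm (u (r k) x - v x) ^ q \<partial>circ) \<longlonglongrightarrow> (\<integral>x. 0 \<partial>circ)"
    proof (rule integral_dominated_convergence[where w="\<lambda>x. 2 ^ q * (\<bar>H x\<bar> ^ q + \<bar>H x\<bar> ^ q)"])
      show "integrable circ (\<lambda>x. 2 ^ q * (\<bar>H x\<bar> ^ q + \<bar>H x\<bar> ^ q))"
        using Hq[OF that(2)] by simp
      show "AE x in circ. (\<lambda>k. norm (u (r k) x - v x) ^ q) \<longlonglongrightarrow> 0"
        using lim
      proof eventually_elim
        fix x assume "(\<lambda>k. u (r k) x) \<longlonglongrightarrow> v x"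
        then have "(\<lambda>k. norm (u (r k) x - v x) ^ q) \<longlonglongrightarrow> norm (v x - v x) ^ q"
          by (intro tendsto_intros)
        moreover have "norm (v x - v x) ^ q = 0" using that(1) by simp
        ultimately show "(\<lambda>k. norm (u (r k) x - v x) ^ q) \<longlonglongrightarrow> 0" by (simp only:)
      qed
      show "AE x in circ. norm (norm (u (r k) x - v x) ^ q) \<le> 2 ^ q * (\<bar>H x\<bar> ^ q + \<bar>H x\<bar> ^ q)" for k
        using AE bound H0
      proof eventually_elim
        fix x assume H: "(\<forall>k. norm (u (r k) x) \<le> H x) \<and> convergent (\<lambda>k. u (r k) x)"
          "norm (v x) \<le> H x" "0 \<le> H x"
        have "norm (u (r k) x - v x) ^ q \<le> 2 ^ q * (norm (u (r k) x) ^ q + norm (v x) ^ q)"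
          by (rule norm_diff_power_le)
        also have "\<dots> \<le> 2 ^ q * (\<bar>H x\<bar> ^ q + \<bar>H x\<bar> ^ q)"
          using H by (intro mult_left_mono add_mono power_mono) auto
        finally show "norm (norm (u (r k) x - v x) ^ q) \<le> 2 ^ q * (\<bar>H x\<bar> ^ q + \<bar>H x\<bar> ^ q)"
          by simp
      qed
    qed auto
    then show ?thesis by simp
  qed
  have "(\<lambda>k. fourier_coeff (u (r k)) j) \<longlonglongrightarrow> fourier_coeff v j" for j
    using diffs[of 1] p
    by (intro fourier_coeff_tendsto Lp_circle_integrable_self[OF u p] Lp_circle_integrable_self[OF v p]) auto
  with that[OF r v lim norms diffs] show ?thesis by blast
qed

definition trig :: "(int \<Rightarrow> complex) \<Rightarrow> int set \<Rightarrow> real \<Rightarrow> complex" where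
  "trig c K x = (\<Sum>k\<in>K. c k * expi k x)"

lemma trig_Lp: "trig c K \<in> Lp_circle p"
proof (rule Lp_circle_bounded)
  show "trig c K \<in> borel_measurable borel" unfolding trig_def by measurable
  show "norm (trig c K x) \<le> (\<Sum>k\<in>K. norm (c k))" for x
    unfolding trig_def by (rule order_trans[OF norm_sum]) (simp add: norm_mult)
qed (simp add: trig_def expi_periodic)

lemma fourier_coeff_trig:
  assumes "finite K"
  shows "fourier_coeff (trig c K) j = (if j \<in> K then c j else 0)"
proof -
  have "fourier_coeff (trig c K) j = (\<Sum>k\<in>K. fourier_coeff (\<lambda>x. c k * expi k x) j)"
    unfolding trig_def
    by (intro fourier_coeff_sum integrable_mult_right Lp_circle_integrable_self[OF expi_Lp[of _ 1]]) simp
  also have "\<dots> = (\<Sum>k\<in>K. if k = j then c k else 0)"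
    by (intro sum.cong) (auto simp: fourier_coeff_cmult fourier_coeff_expi)
  finally show ?thesis using assms by simp
qed

lemma integral_mult_cnj_trig:
  assumes "integrable circ u"
  shows "(\<integral>x. u x * cnj (trig c K x) \<partial>circ) = 2 * pi * (\<Sum>k\<in>K. cnj (c k) * fourier_coeff u k)"
proof -
  have "u x * cnj (trig c K x) = (\<Sum>k\<in>K. cnj (c k) * (u x * expi (-k) x))" for x
    by (simp add: trig_def cnj_expi sum_distrib_left mult_ac)
  then have "(\<integral>x. u x * cnj (trig c K x) \<partial>circ) = (\<Sum>k\<in>K. cnj (c k) * (\<integral>x. u x * expi (-k) x \<partial>circ))"
    using assms by (simp add: integrable_mult_expi)
  then show ?thesis
    by (simp add: fourier_coeff_circ sum_distrib_left)
qed

lemma integral_norm_trig: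
  assumes "finite K"
  shows "(\<integral>x. (norm (trig c K x))\<^sup>2 \<partial>circ) = 2 * pi * (\<Sum>k\<in>K. (norm (c k))\<^sup>2)"
proof -
  have "complex_of_real (\<integral>x. (norm (trig c K x))\<^sup>2 \<partial>circ)
      = (\<integral>x. complex_of_real ((norm (trig c K x))\<^sup>2) \<partial>circ)"
    by (rule integral_of_real[symmetric]) (rule Lp_circle_integrable[OF trig_Lp])
  also have "\<dots> = (\<integral>x. trig c K x * cnj (trig c K x) \<partial>circ)"
    by (simp only: complex_norm_square)
  also have "\<dots> = 2 * pi * (\<Sum>k\<in>K. cnj (c k) * fourier_coeff (trig c K) k)"
    by (intro integral_mult_cnj_trig Lp_circle_integrable_self[OF trig_Lp[of _ _ 1]]) simp
  also have "(\<Sum>k\<in>K. cnj (c k) * fourier_coeff (trig c K) k) = (\<Sum>k\<in>K. of_real ((norm (c k))\<^sup>2))"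
    using assms by (intro sum.cong)
      (auto simp: fourier_coeff_trig complex_norm_square mult.commute simp del: of_real_power)
  also have "complex_of_real (2 * pi) * \<dots> = of_real (2 * pi * (\<Sum>k\<in>K. (norm (c k))\<^sup>2))"
    by simp
  finally show ?thesis by (simp only: of_real_eq_iff)
qed

text \<open>Expand \<open>0 \<le> \<parallel>u - T\<parallel>\<^sup>2\<close> for the orthogonal projection \<open>T\<close> of \<open>u\<close> onto the frequencies in \<open>K\<close>.\<close>

lemma Bessel_inequality:
  assumes u: "u \<in> Lp_circle 2" and "finite K"
  shows "2 * pi * (\<Sum>k\<in>K. (norm (fourier_coeff u k))\<^sup>2) \<le> (\<integral>x. (norm (u x))\<^sup>2 \<partial>circ)"
proof -
  let ?T = "trig (fourier_coeff u) K"
  have uint: "integrable circ u" by (rule Lp_circle_integrable_self[OF u]) simp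
  have [measurable]: "cnj \<in> borel_measurable borel"
    by (intro borel_measurable_continuous_onI continuous_intros)
  have [measurable]: "u \<in> borel_measurable borel" "?T \<in> borel_measurable borel"
    using u trig_Lp by (auto intro: Lp_circle_borel)
  have u2: "integrable circ (\<lambda>x. (norm (u x))\<^sup>2)" by (rule Lp_circle_integrable[OF u])
  have T2: "integrable circ (\<lambda>x. (norm (?T x))\<^sup>2)" by (rule Lp_circle_integrable[OF trig_Lp])
  have uT: "integrable circ (\<lambda>x. u x * cnj (?T x))"
  proof (rule Bochner_Integration.integrable_bound)
    show "integrable circ (\<lambda>x. (norm (u x))\<^sup>2 + (norm (?T x))\<^sup>2)" using u2 T2 by simp
    have "a * b \<le> a\<^sup>2 + b\<^sup>2" for a b :: real
      using sum_squares_bound[of a b] zero_le_power2[of a] zero_le_power2[of b] by linarith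
    then show "AE x in circ. norm (u x * cnj (?T x)) \<le> norm ((norm (u x))\<^sup>2 + (norm (?T x))\<^sup>2)"
      by (auto simp: norm_mult)
  qed simp
  have id: "(norm (u x - ?T x))\<^sup>2 = (norm (u x))\<^sup>2 - 2 * Re (u x * cnj (?T x)) + (norm (?T x))\<^sup>2" for x
    unfolding cmod_power2 by (simp add: power2_eq_square algebra_simps)
  have Re: "(\<integral>x. Re (u x * cnj (?T x)) \<partial>circ) = 2 * pi * (\<Sum>k\<in>K. (norm (fourier_coeff u k))\<^sup>2)"
  proof -
    have "(\<integral>x. Re (u x * cnj (?T x)) \<partial>circ) = Re (\<integral>x. u x * cnj (?T x) \<partial>circ)"
      using uT by (rule integral_Re)
    also have "\<dots> = Re (2 * pi * (\<Sum>k\<in>K. cnj (fourier_coeff u k) * fourier_coeff u k))"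
      by (simp only: integral_mult_cnj_trig[OF uint])
    also have "(\<Sum>k\<in>K. cnj (fourier_coeff u k) * fourier_coeff u k)
        = complex_of_real (\<Sum>k\<in>K. (norm (fourier_coeff u k))\<^sup>2)"
      by (simp add: complex_norm_square mult.commute del: of_real_power)
    finally show ?thesis by simp
  qed
  have "0 \<le> (\<integral>x. (norm (u x - ?T x))\<^sup>2 \<partial>circ)" by simp
  also have "\<dots> = (\<integral>x. (norm (u x))\<^sup>2 \<partial>circ) - 2 * (\<integral>x. Re (u x * cnj (?T x)) \<partial>circ)
      + (\<integral>x. (norm (?T x))\<^sup>2 \<partial>circ)"
    unfolding id using u2 T2 integrable_Re[OF uT] by (simp del: times_complex.sel)
  finally show ?thesis using integral_norm_trig[OF \<open>finite K\<close>] Re by simp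
qed

abbreviation freqs :: "nat \<Rightarrow> int set" where
  "freqs N \<equiv> {- int N..int N}"

text \<open>
  The trigonometric partial sums are Cauchy in \<open>L\<^sup>2\<close> by orthogonality. The norm of the limit is
  recorded here because it is the source of Parseval's identity once coefficients are known to
  determine a function.
\<close>

theorem Riesz_Fischer:
  assumes bound: "\<And>N. (\<Sum>k\<in>freqs N. (norm (c k))\<^sup>2) \<le> B"
  obtains v where "v \<in> Lp_circle 2" "\<And>k. fourier_coeff v k = c k"
    "(\<lambda>N. 2 * pi * (\<Sum>k\<in>freqs N. (norm (c k))\<^sup>2)) \<longlonglongrightarrow> (\<integral>x. (norm (v x))\<^sup>2 \<partial>circ)"
proof -
  define s where "s = (\<lambda>N. 2 * pi * (\<Sum>k\<in>freqs N. (norm (c k))\<^sup>2))"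
  have mono: "s m \<le> s n" if "m \<le> n" for m n
    unfolding s_def using that by (intro mult_left_mono sum_mono2) auto
  have "convergent s"
    by (rule Bseq_mono_convergent[OF BseqI'[where K="2*pi*B"]])
      (use bound mono in \<open>auto simp: s_def sum_nonneg abs_mult abs_of_nonneg\<close>)
  then have C: "Cauchy s" by (rule convergent_Cauchy)
  have diff: "(\<integral>x. (norm (trig c (freqs m) x - trig c (freqs n) x))\<^sup>2 \<partial>circ) = s m - s n"
    if "n \<le> m" for m n
  proof -
    have sub: "freqs n \<subseteq> freqs m" using that by auto
    have "trig c (freqs m) x - trig c (freqs n) x = trig c (freqs m - freqs n) x" for x
      unfolding trig_def using sub by (simp add: sum_diff)
    then show ?thesis
      unfolding s_def using sub by (simp add: integral_norm_trig sum_diff right_diff_distrib)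
  qed
  have diff': "(\<integral>x. (norm (trig c (freqs m) x - trig c (freqs n) x))\<^sup>2 \<partial>circ) = \<bar>s m - s n\<bar>" for m n
  proof (cases "n \<le> m")
    case True
    then show ?thesis using diff mono by simp
  next
    case False
    then show ?thesis using diff[of m n] mono[of m n] by (simp add: norm_minus_commute)
  qed
  have cauchy: "\<exists>N. \<forall>m\<ge>N. \<forall>n\<ge>N. (\<integral>x. (norm (trig c (freqs m) x - trig c (freqs n) x))\<^sup>2 \<partial>circ) < e"
    if "e > 0" for e
    unfolding diff' using C that by (simp add: Cauchy_def dist_real_def)
  obtain r v where r: "strict_mono r" and v: "v \<in> Lp_circle 2"
    and norms: "\<And>q. q \<le> 2 \<Longrightarrow> (\<lambda>k. \<integral>x. norm (trig c (freqs (r k)) x) ^ q \<partial>circ)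
        \<longlonglongrightarrow> (\<integral>x. norm (v x) ^ q \<partial>circ)"
    and coeffs: "\<And>j. (\<lambda>k. fourier_coeff (trig c (freqs (r k))) j) \<longlonglongrightarrow> fourier_coeff v j"
    by (rule Lp_circle_complete[of "\<lambda>n. trig c (freqs n)" 2, OF trig_Lp _ cauchy]) auto
  have "fourier_coeff v j = c j" for j
  proof (rule LIMSEQ_unique[OF coeffs])
    have "\<forall>\<^sub>F k in sequentially. fourier_coeff (trig c (freqs (r k))) j = c j"
      using eventually_ge_at_top[of "nat \<bar>j\<bar>"]
    proof eventually_elim
      fix k assume "nat \<bar>j\<bar> \<le> k"
      moreover have "k \<le> r k" by (rule seq_suble[OF r])
      ultimately show "fourier_coeff (trig c (freqs (r k))) j = c j"
        by (auto simp: fourier_coeff_trig)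
    qed
    then show "(\<lambda>k. fourier_coeff (trig c (freqs (r k))) j) \<longlonglongrightarrow> c j"
      by (rule tendsto_eventually)
  qed
  moreover have "s \<longlonglongrightarrow> (\<integral>x. (norm (v x))\<^sup>2 \<partial>circ)"
  proof -
    obtain l where l: "s \<longlonglongrightarrow> l" using \<open>convergent s\<close> by (auto simp: convergent_def)
    have "(\<lambda>k. s (r k)) \<longlonglongrightarrow> l" using LIMSEQ_subseq_LIMSEQ[OF l r] by (simp add: o_def)
    moreover have "(\<lambda>k. s (r k)) \<longlonglongrightarrow> (\<integral>x. (norm (v x))\<^sup>2 \<partial>circ)"
      using norms[of 2] by (simp add: integral_norm_trig s_def)
    ultimately show ?thesis using l LIMSEQ_unique by blast
  qed
  ultimately show ?thesis using that[OF v] by (simp add: s_def)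
qed

section \<open>Uniqueness of Fourier coefficients\<close>

definition vanishing_coeffs :: "(real \<Rightarrow> complex) \<Rightarrow> bool" where
  "vanishing_coeffs w \<longleftrightarrow> integrable circ w \<and> (\<forall>k. fourier_coeff w k = 0)"

lemma vanishing_coeffs_add:
  assumes "vanishing_coeffs v" "vanishing_coeffs w"
  shows "vanishing_coeffs (\<lambda>x. v x + w x)"
proof -
  have "integrable circ (\<lambda>x. - w x)" "fourier_coeff (\<lambda>x. - w x) k = - fourier_coeff w k" for k
    using assms(2) fourier_coeff_cmult[of "-1" w k] by (auto simp: vanishing_coeffs_def)
  then show ?thesis
    using assms fourier_coeff_diff[of v "\<lambda>x. - w x"] by (auto simp: vanishing_coeffs_def)
qed

lemma vanishing_coeffs_cmult: "vanishing_coeffs w \<Longrightarrow> vanishing_coeffs (\<lambda>x. c * w x)"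
  by (auto simp: vanishing_coeffs_def fourier_coeff_cmult)

lemma vanishing_coeffs_expi:
  assumes "vanishing_coeffs w"
  shows "vanishing_coeffs (\<lambda>x. expi j x * w x)"
proof -
  have "fourier_coeff (\<lambda>x. expi j x * w x) k = fourier_coeff w (k - j)" for k
    by (simp add: fourier_coeff_circ mult.assoc mult.left_commute[of "expi j _"] expi_mult)
  then show ?thesis
    using assms integrable_mult_expi[of w j] by (auto simp: vanishing_coeffs_def mult.commute)
qed

text \<open>
  Multiplication by \<open>Re (cis x)\<close> or \<open>Im (cis x)\<close> only shifts frequencies by one, so the
  functions with vanishing coefficients form a module over the polynomials on the circle.
\<close>

lemma vanishing_coeffs_polynomial:
  fixes \<phi> :: "complex \<Rightarrow> real"
  assumes "real_polynomial_function \<phi>" "vanishing_coeffs w"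
  shows "vanishing_coeffs (\<lambda>x. of_real (\<phi> (cis x)) * w x)"
  using assms
proof (induction arbitrary: w rule: real_polynomial_function.induct)
  case (linear f)
  then interpret bounded_linear f by simp
  have f: "f z = Re z * f 1 + Im z * f \<i>" for z
  proof -
    have "f z = f (Re z *\<^sub>R 1 + Im z *\<^sub>R \<i>)"
      by (rule arg_cong[of _ _ f]) (simp add: complex_eq_iff)
    then show ?thesis by (simp only: add scaleR real_scaleR_def)
  qed
  define a where "a = (of_real (f 1) - \<i> * of_real (f \<i>)) / 2"
  define b where "b = (of_real (f 1) + \<i> * of_real (f \<i>)) / 2"
  have "of_real (f (cis x)) = a * expi 1 x + b * expi (-1) x" for x
    by (subst f) (simp add: complex_eq_iff a_def b_def expi_def field_simps)
  then have "(\<lambda>x. of_real (f (cis x)) * w x)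
      = (\<lambda>x. a * (expi 1 x * w x) + b * (expi (-1) x * w x))"
    by (simp add: algebra_simps)
  then show ?case
    using linear.prems
    by (simp add: vanishing_coeffs_add vanishing_coeffs_cmult vanishing_coeffs_expi)
next
  case (const c)
  then show ?case by (rule vanishing_coeffs_cmult)
next
  case (add f g)
  then show ?case by (simp add: vanishing_coeffs_add distrib_right)
next
  case (mult f g)
  then show ?case by (simp add: mult.assoc)
qed

lemma integrable_continuous_cis_mult:
  fixes \<phi> :: "complex \<Rightarrow> real" and w :: "real \<Rightarrow> complex"
  assumes "continuous_on UNIV \<phi>" "integrable circ w"
  shows "integrable circ (\<lambda>x. of_real (\<phi> (cis x)) * w x)"
proof -
  have [measurable]: "(\<lambda>x. \<phi> (cis x)) \<in> borel_measurable borel"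
    by (intro borel_measurable_continuous_onI continuous_on_compose2[OF assms(1)]) (auto intro!: continuous_intros)
  have "compact (\<phi> ` sphere 0 1)"
    by (intro compact_continuous_image continuous_on_subset[OF assms(1)]) auto
  then obtain B where B: "\<And>z. z \<in> sphere 0 1 \<Longrightarrow> norm (\<phi> z) \<le> B"
    by (meson compact_imp_bounded bounded_iff imageI)
  show ?thesis
  proof (rule Bochner_Integration.integrable_bound)
    show "integrable circ (\<lambda>x. B * norm (w x))" using assms(2) by simp
    have "\<bar>\<phi> (cis x)\<bar> \<le> \<bar>B\<bar>" for x using B[of "cis x"] by simp
    then show "AE x in circ. norm (of_real (\<phi> (cis x)) * w x) \<le> norm (B * norm (w x))"
      by (auto simp: norm_mult abs_mult intro!: mult_right_mono)
    show "(\<lambda>x. of_real (\<phi> (cis x)) * w x) \<in> borel_measurable circ"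
      using borel_measurable_integrable[OF assms(2)] by measurable
  qed
qed

text \<open>By Stone-Weierstrass, continuous functions on the circle are uniform limits of polynomials.\<close>

lemma vanishing_coeffs_integral_continuous:
  fixes \<phi> :: "complex \<Rightarrow> real"
  assumes w: "vanishing_coeffs w" and \<phi>: "continuous_on UNIV \<phi>"
  shows "(\<integral>x. of_real (\<phi> (cis x)) * w x \<partial>circ) = 0"
proof -
  have wint: "integrable circ w" using w by (simp add: vanishing_coeffs_def)
  let ?A = "\<integral>x. norm (w x) \<partial>circ"
  have le: "norm (\<integral>x. of_real (\<phi> (cis x)) * w x \<partial>circ) \<le> e * ?A" if "e > 0" for e
  proof -
    obtain g where g: "real_polynomial_function g" and close: "\<And>z. z \<in> sphere 0 1 \<Longrightarrow> \<bar>\<phi> z - g z\<bar> < e"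
      by (rule Stone_Weierstrass_real_polynomial_function[of "sphere 0 1" \<phi> e])
        (use \<open>e > 0\<close> continuous_on_subset[OF \<phi>, of "sphere 0 1"] in auto)
    have gw: "vanishing_coeffs (\<lambda>x. of_real (g (cis x)) * w x)"
      by (rule vanishing_coeffs_polynomial[OF g w])
    then have gint: "integrable circ (\<lambda>x. of_real (g (cis x)) * w x)"
      by (simp add: vanishing_coeffs_def)
    have g0: "(\<integral>x. of_real (g (cis x)) * w x \<partial>circ) = 0"
      using gw fourier_coeff_circ[of "\<lambda>x. of_real (g (cis x)) * w x" 0]
      by (simp add: vanishing_coeffs_def)
    have fint: "integrable circ (\<lambda>x. of_real (\<phi> (cis x)) * w x)"
      by (rule integrable_continuous_cis_mult[OF \<phi> wint])
    have "norm (\<integral>x. of_real (\<phi> (cis x)) * w x \<partial>circ)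
        = norm (\<integral>x. of_real (\<phi> (cis x)) * w x - of_real (g (cis x)) * w x \<partial>circ)"
      using fint gint g0 by simp
    also have "\<dots> \<le> (\<integral>x. norm (of_real (\<phi> (cis x)) * w x - of_real (g (cis x)) * w x) \<partial>circ)"
      by (rule integral_norm_bound)
    also have "\<dots> \<le> (\<integral>x. e * norm (w x) \<partial>circ)"
    proof (rule integral_mono)
      fix x
      have "norm (of_real (\<phi> (cis x)) * w x - of_real (g (cis x)) * w x)
          = \<bar>\<phi> (cis x) - g (cis x)\<bar> * norm (w x)"
        by (simp add: left_diff_distrib[symmetric] norm_mult del: of_real_diff)
          (metis norm_of_real of_real_diff real_norm_def)
      also have "\<dots> \<le> e * norm (w x)"
        using close[of "cis x"] by (intro mult_right_mono) auto
      finally show "norm (of_real (\<phi> (cis x)) * w x - of_real (g (cis x)) * w x) \<le> e * norm (w x)" .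
    qed (use fint gint wint in auto)
    finally show ?thesis by simp
  qed
  have "norm (\<integral>x. of_real (\<phi> (cis x)) * w x \<partial>circ) \<le> 0"
  proof (rule field_le_epsilon)
    fix e :: real assume "e > 0"
    have A: "?A \<ge> 0" by simp
    have "norm (\<integral>x. of_real (\<phi> (cis x)) * w x \<partial>circ) \<le> e / (?A + 1) * ?A"
      using A \<open>e > 0\<close> by (intro le) (simp add: divide_pos_pos add_nonneg_pos)
    also have "e / (a + 1) * a \<le> e" if "a \<ge> 0" for a
      using \<open>e > 0\<close> that by (simp add: field_simps)
    from this[OF A] have "e / (?A + 1) * ?A \<le> e" .
    finally show "norm (\<integral>x. of_real (\<phi> (cis x)) * w x \<partial>circ) \<le> 0 + e" by simp
  qed
  then show ?thesis by simp
qed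

text \<open>
  Indicators of closed sets are decreasing limits of continuous functions of the distance. Working
  with closed subsets of the plane avoids discussing periodicity of test functions.
\<close>

lemma vanishing_coeffs_integral_closed:
  assumes w: "vanishing_coeffs w" and C: "closed C"
  shows "(\<integral>x. indicator C (cis x) * w x \<partial>circ) = 0"
proof (cases "C = {}")
  case False
  have wint: "integrable circ w" using w by (simp add: vanishing_coeffs_def)
  have [measurable]: "w \<in> borel_measurable circ" using wint by simp
  have [measurable]: "C \<in> sets borel" using C by simp
  have [measurable]: "cis \<in> borel_measurable borel"
    by (intro borel_measurable_continuous_onI continuous_intros)
  define \<phi> where "\<phi> = (\<lambda>n z. max 0 (1 - real n * infdist z C))"
  have \<phi>: "continuous_on UNIV (\<phi> n)" for n
    unfolding \<phi>_def by (intro continuous_intros)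
  have [measurable]: "\<phi> n \<in> borel_measurable borel" for n
    by (intro borel_measurable_continuous_onI \<phi>)
  have lim: "(\<lambda>n. \<phi> n z) \<longlonglongrightarrow> indicator C z" for z
  proof (cases "z \<in> C")
    case True
    then show ?thesis by (simp add: \<phi>_def)
  next
    case notin: False
    then have pos: "infdist z C > 0"
      using in_closed_iff_infdist_zero[OF C False, of z] infdist_nonneg[of z C] by linarith
    then obtain N where N: "1 < real N * infdist z C" using reals_Archimedean3 by blast
    have "\<forall>\<^sub>F n in sequentially. \<phi> n z = 0"
      using eventually_ge_at_top[of N]
    proof eventually_elim
      fix n assume "N \<le> n"
      then have "real N * infdist z C \<le> real n * infdist z C" using pos by simp
      then show "\<phi> n z = 0" using N by (simp add: \<phi>_def)
    qed
    then show ?thesis using notin by (simp add: tendsto_eventually)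
  qed
  have "(\<lambda>n. \<integral>x. of_real (\<phi> n (cis x)) * w x \<partial>circ) \<longlonglongrightarrow> (\<integral>x. of_real (indicator C (cis x)) * w x \<partial>circ)"
  proof (rule integral_dominated_convergence[where w="\<lambda>x. norm (w x)"])
    show "AE x in circ. (\<lambda>n. of_real (\<phi> n (cis x)) * w x) \<longlonglongrightarrow> of_real (indicator C (cis x)) * w x"
      by (intro AE_I2 tendsto_intros lim)
    have "\<bar>\<phi> n z\<bar> \<le> 1" for n z using infdist_nonneg[of z C] by (simp add: \<phi>_def)
    then show "AE x in circ. norm (of_real (\<phi> n (cis x)) * w x) \<le> norm (w x)" for n
      by (simp add: norm_mult mult_left_le_one_le)
  qed (use wint in auto)
  moreover have "of_real (indicator C z) = (indicator C z :: complex)" for z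
    by (simp add: indicator_def)
  ultimately show ?thesis
    using LIMSEQ_unique[OF _ tendsto_const[of 0]]
    by (simp add: vanishing_coeffs_integral_continuous[OF w \<phi>])
qed simp

text \<open>Asymmetric in \<open>x\<close> and \<open>y\<close> because \<open>cis\<close> identifies the two endpoints of the period.\<close>

lemma cis_inj_circ:
  assumes "cis x = cis y" "x \<in> {0..2*pi}" "0 < y" "y < 2 * pi"
  shows "x = y"
proof -
  have "sin x = sin y \<and> cos x = cos y" using assms(1) by (auto simp: complex_eq_iff)
  then obtain n :: int where n: "x = y + 2 * pi * n" by (auto simp: sin_cos_eq_iff)
  have "\<bar>2 * pi * n\<bar> < 2 * pi" using n assms by auto
  then have "\<bar>real_of_int n\<bar> < 1" by (simp add: abs_mult)
  then show ?thesis using n by simp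
qed

text \<open>
  If \<open>Re w\<close> were positive on a set of positive measure, it would be so on a compact set of
  positive measure, whose image under \<open>cis\<close> is closed.
\<close>

lemma vanishing_coeffs_Re_nonpos:
  assumes w: "vanishing_coeffs w" and [measurable]: "w \<in> borel_measurable borel"
  shows "AE x in circ. Re (w x) \<le> 0"
proof -
  have wint: "integrable circ w" using w by (simp add: vanishing_coeffs_def)
  define A where "A = {x \<in> {0<..<2*pi}. Re (w x) > 0}"
  have [measurable]: "A \<in> sets borel" unfolding A_def by measurable
  have "emeasure lebesgue A \<le> ennreal e" if e: "e > 0" for e :: real
  proof -
    obtain T where T: "closed T" "T \<subseteq> A" "A - T \<in> lmeasurable" "emeasure lebesgue (A - T) < ennreal e"
      by (rule sets_lebesgue_inner_closed[of A e]) (use e in auto)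
    have Tb[measurable]: "T \<in> sets borel" using T(1) by simp
    have "bounded T" using T(2) by (intro bounded_subset[OF bounded_closed_interval[of 0 "2*pi"]]) (auto simp: A_def)
    then have "compact T" using T(1) by (simp add: compact_eq_bounded_closed)
    then have "closed (cis ` T)"
      by (intro compact_imp_closed compact_continuous_image continuous_intros)
    have "(\<integral>x. indicator T x * w x \<partial>circ) = 0"
    proof -
      have "(\<integral>x. indicator T x * w x \<partial>circ) = (\<integral>x. indicator (cis ` T) (cis x) * w x \<partial>circ)"
      proof (rule Bochner_Integration.integral_cong[OF refl])
        fix x assume "x \<in> space circ"
        then have "cis x \<in> cis ` T \<longleftrightarrow> x \<in> T"
          using T(2) cis_inj_circ[of x] by (auto simp: A_def)
        then show "indicator T x * w x = indicator (cis ` T) (cis x) * w x"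
          by (simp add: indicator_def)
      qed
      then show ?thesis using vanishing_coeffs_integral_closed[OF w \<open>closed (cis ` T)\<close>] by simp
    qed
    moreover have iT: "integrable circ (\<lambda>x. indicator T x * w x)"
    proof (rule Bochner_Integration.integrable_bound[OF wint])
      show "(\<lambda>x. indicator T x * w x) \<in> borel_measurable circ" by measurable
    qed (auto simp: indicator_def)
    ultimately have "(\<integral>x. Re (indicator T x * w x) \<partial>circ) = 0"
      by (simp only: integral_Re zero_complex.sel)
    moreover have nn: "Re (indicator T x * w x) \<ge> 0" for x
      using T(2) by (auto simp: indicator_def A_def)
    ultimately have "AE x in circ. Re (indicator T x * w x) = 0"
      using integral_nonneg_eq_0_iff_AE[OF integrable_Re[OF iT]] by auto
    then have "AE x in circ. x \<notin> T"
      by eventually_elim (use T(2) in \<open>auto simp: indicator_def A_def split: if_splits\<close>)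
    then have "AE x in lborel. x \<notin> T"
      unfolding circ_def by (subst (asm) AE_restrict_space_iff) (use T(2) in \<open>auto simp: A_def elim!: eventually_mono\<close>)
    then have "T \<in> null_sets lborel" using Tb by (subst AE_iff_null_sets) auto
    then have "emeasure lebesgue T = 0" by (simp add: null_sets_def)
    moreover have "emeasure lebesgue A \<le> emeasure lebesgue T + emeasure lebesgue (A - T)"
      using T(2) emeasure_subadditive[of T lebesgue "A - T"] T(3)
      by (simp add: Un_absorb1 fmeasurable_def)
    ultimately show ?thesis using T(4) by simp
  qed
  then have "emeasure lebesgue A \<le> 0 + ennreal e" if "e > 0" for e using that by simp
  then have "emeasure lebesgue A \<le> 0" by (rule ennreal_le_epsilon)
  then have "A \<in> null_sets lborel" by (simp add: null_sets_def)
  then have "AE x in lborel. x \<notin> A" by (rule AE_not_in)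
  moreover have "AE x in lborel. x \<noteq> 0 \<and> x \<noteq> 2 * pi"
    using AE_lborel_singleton[of 0] AE_lborel_singleton[of "2*pi"] by eventually_elim auto
  ultimately have "AE x in lborel. x \<in> {0..2*pi} \<longrightarrow> Re (w x) \<le> 0"
    by eventually_elim (auto simp: A_def)
  then show ?thesis unfolding circ_def by (subst AE_restrict_space_iff) auto
qed

lemma vanishing_coeffs_imp_zero:
  assumes w: "vanishing_coeffs w" and [measurable]: "w \<in> borel_measurable borel"
  shows "AE x in circ. w x = 0"
proof -
  have "AE x in circ. Re (c * w x) \<le> 0" for c
    using vanishing_coeffs_Re_nonpos[OF vanishing_coeffs_cmult[OF w, of c]] by simp
  from this[of 1] this[of "-1"] this[of "\<i>"] this[of "-\<i>"]
  show ?thesis by eventually_elim (simp add: complex_eq_iff)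
qed

theorem fourier_coeff_unique:
  assumes u: "u \<in> Lp_circle p" and v: "v \<in> Lp_circle p" and p: "p > 0"
    and eq: "\<And>k. fourier_coeff u k = fourier_coeff v k"
  shows "AE x in circ. u x = v x"
proof -
  have [measurable]: "u \<in> borel_measurable borel" "v \<in> borel_measurable borel"
    using u v by (auto intro: Lp_circle_borel)
  have "vanishing_coeffs (\<lambda>x. u x - v x)"
    using Lp_circle_integrable_self[OF u p] Lp_circle_integrable_self[OF v p] eq
    by (simp add: vanishing_coeffs_def fourier_coeff_diff)
  from vanishing_coeffs_imp_zero[OF this] show ?thesis by simp
qed

text \<open>
  The function that Riesz-Fischer builds from the coefficients of \<open>u\<close> has the right norm, and by
  uniqueness it is \<open>u\<close>.
\<close>

theorem Parseval:
  assumes u: "u \<in> Lp_circle 2"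
  shows "(\<lambda>N. 2 * pi * (\<Sum>k\<in>freqs N. (norm (fourier_coeff u k))\<^sup>2)) \<longlonglongrightarrow> (\<integral>x. (norm (u x))\<^sup>2 \<partial>circ)"
proof -
  have "(\<Sum>k\<in>freqs N. (norm (fourier_coeff u k))\<^sup>2) \<le> (\<integral>x. (norm (u x))\<^sup>2 \<partial>circ) / (2 * pi)" for N
    using Bessel_inequality[OF u, of "freqs N"] by (simp add: field_simps)
  then obtain v where v: "v \<in> Lp_circle 2" "\<And>k. fourier_coeff v k = fourier_coeff u k"
    "(\<lambda>N. 2 * pi * (\<Sum>k\<in>freqs N. (norm (fourier_coeff u k))\<^sup>2)) \<longlonglongrightarrow> (\<integral>x. (norm (v x))\<^sup>2 \<partial>circ)"
    by (rule Riesz_Fischer[of "fourier_coeff u"]) blast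
  have "AE x in circ. v x = u x"
    by (rule fourier_coeff_unique[OF v(1) u]) (auto simp: v(2))
  then have "(\<integral>x. (norm (v x))\<^sup>2 \<partial>circ) = (\<integral>x. (norm (u x))\<^sup>2 \<partial>circ)"
    using Lp_circle_borel[OF v(1)] Lp_circle_borel[OF u]
    by (intro integral_cong_AE) (auto elim!: eventually_mono intro!: borel_measurable_circ)
  with v(3) show ?thesis by simp
qed

section \<open>Fourier multipliers, positive frequencies and the mass\<close>

text \<open>Countably many translates of one period cover the line.\<close>

lemma AE_circ_periodic:
  assumes [measurable]: "u \<in> borel_measurable borel" "v \<in> borel_measurable borel"
    and per: "\<And>x. u (x + 2 * pi) = u x" "\<And>x. v (x + 2 * pi) = v x"
    and AE: "AE x in circ. u x = (v x :: complex)"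
  shows "AE x in lborel. u x = v x"
proof -
  have shift: "u (x + 2 * pi * of_int k) = v (x + 2 * pi * of_int k) \<longleftrightarrow> u x = v x" for x k
  proof (induction k rule: int_induct[where k=0])
    case (step1 i)
    then show ?case
      using per[of "x + 2 * pi * of_int i"] by (simp add: algebra_simps)
  next
    case (step2 i)
    then show ?case
      using per[of "x + 2 * pi * of_int (i - 1)"] by (simp add: algebra_simps)
  qed simp
  have "AE x in lborel. x \<in> {0..2*pi} \<longrightarrow> u x = v x"
    using AE unfolding circ_def by (subst (asm) AE_restrict_space_iff) auto
  then have "AE x in lborel. (c + 1 * x) \<in> {0..2*pi} \<longrightarrow> u (c + 1 * x) = v (c + 1 * x)" for c
    by (intro AE_borel_affine) auto
  then have "AE x in lborel. \<forall>k::int. (x + 2 * pi * of_int k) \<in> {0..2*pi} \<longrightarrow>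
      u (x + 2 * pi * of_int k) = v (x + 2 * pi * of_int k)"
    unfolding AE_all_countable by (simp add: add.commute[of _ "2 * pi * _"])
  then show ?thesis
  proof eventually_elim
    fix x
    assume *: "\<forall>k::int. (x + 2 * pi * of_int k) \<in> {0..2*pi} \<longrightarrow>
      u (x + 2 * pi * of_int k) = v (x + 2 * pi * of_int k)"
    define k where "k = - \<lfloor>x / (2 * pi)\<rfloor>"
    have pi2: "0 < 2 * pi" by simp
    have "of_int \<lfloor>x / (2 * pi)\<rfloor> \<le> x / (2 * pi)" "x / (2 * pi) < of_int \<lfloor>x / (2 * pi)\<rfloor> + 1"
      by linarith+
    then have "of_int \<lfloor>x / (2 * pi)\<rfloor> * (2 * pi) \<le> x" "x < (of_int \<lfloor>x / (2 * pi)\<rfloor> + 1) * (2 * pi)"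
      by (simp_all only: pos_le_divide_eq[OF pi2] pos_divide_less_eq[OF pi2])
    then have "x + 2 * pi * of_int k \<in> {0..2*pi}"
      by (simp add: k_def algebra_simps)
    then show "u x = v x" using * shift by blast
  qed
qed

lemma fourier_coeff_cong_AE:
  assumes "u \<in> borel_measurable borel" "v \<in> borel_measurable borel" "AE x in circ. u x = v x"
  shows "fourier_coeff u k = fourier_coeff v k"
proof -
  have [measurable]: "u \<in> borel_measurable borel" "v \<in> borel_measurable borel" by fact+
  have "(\<integral>x. u x * expi (- k) x \<partial>circ) = (\<integral>x. v x * expi (- k) x \<partial>circ)"
    using assms(3) by (intro integral_cong_AE) (auto elim: eventually_mono)
  then show ?thesis by (simp add: fourier_coeff_circ)
qed

text \<open>Riesz-Fischer shows that the choice in the definition of a multiplier is not vacuous.\<close>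

lemma fourier_multiplier_spec:
  assumes u: "u \<in> Lp_circle 2" and m: "\<And>k. norm (m k) \<le> 1"
  shows "fourier_multiplier m u \<in> Lp_circle 2"
    and "fourier_coeff (fourier_multiplier m u) k = m k * fourier_coeff u k"
proof -
  have "(\<Sum>k\<in>freqs N. (norm (m k * fourier_coeff u k))\<^sup>2) \<le> (\<integral>x. (norm (u x))\<^sup>2 \<partial>circ) / (2 * pi)" for N
  proof -
    have "(\<Sum>k\<in>freqs N. (norm (m k * fourier_coeff u k))\<^sup>2) \<le> (\<Sum>k\<in>freqs N. (norm (fourier_coeff u k))\<^sup>2)"
      using m by (intro sum_mono power_mono) (auto simp: norm_mult mult_left_le_one_le)
    also have "\<dots> \<le> (\<integral>x. (norm (u x))\<^sup>2 \<partial>circ) / (2 * pi)"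
      using Bessel_inequality[OF u, of "freqs N"] by (simp add: field_simps)
    finally show ?thesis .
  qed
  then obtain v where "v \<in> Lp_circle 2" "\<And>k. fourier_coeff v k = m k * fourier_coeff u k"
    by (rule Riesz_Fischer) blast
  then have "\<exists>v. v \<in> Lp_circle 2 \<and> (\<forall>k. fourier_coeff v k = m k * fourier_coeff u k)" by blast
  from someI_ex[OF this]
  show "fourier_multiplier m u \<in> Lp_circle 2"
    and "fourier_coeff (fourier_multiplier m u) k = m k * fourier_coeff u k"
    unfolding fourier_multiplier_def by auto
qed

text \<open>
  Unlike the equation \<open>proj_plus u = u\<close>, the condition on the coefficients is visibly linear and
  closed under convergence of coefficients.
\<close>

lemma W_plus_iff:
  "u \<in> W_plus \<longleftrightarrow> u \<in> W_quarter_4 \<and> (\<forall>k\<le>0. fourier_coeff u k = 0)"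
proof (cases "u \<in> W_quarter_4")
  case True
  then have u: "u \<in> Lp_circle 2"
    using Lp_circle_mono[of u 4 2] by (simp add: W_quarter_4_def)
  have p: "proj_plus u \<in> Lp_circle 2"
      "\<And>k. fourier_coeff (proj_plus u) k = indicator {1..} k * fourier_coeff u k"
    unfolding proj_plus_def by (intro fourier_multiplier_spec u; simp add: indicator_def)+
  show ?thesis
  proof
    assume "u \<in> W_plus"
    then have "AE x in circ. proj_plus u x = u x" by (auto simp: W_plus_def intro: AE_circ)
    then have "fourier_coeff (proj_plus u) k = fourier_coeff u k" for k
      by (intro fourier_coeff_cong_AE Lp_circle_borel[OF u] Lp_circle_borel[OF p(1)])
    then show "u \<in> W_quarter_4 \<and> (\<forall>k\<le>0. fourier_coeff u k = 0)"
      using True p(2) by (metis atLeast_iff indicator_simps(2) mult_zero_left not_one_le_zero order_trans)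
  next
    assume *: "u \<in> W_quarter_4 \<and> (\<forall>k\<le>0. fourier_coeff u k = 0)"
    have "AE x in circ. proj_plus u x = u x"
    proof (rule fourier_coeff_unique[OF p(1) u])
      show "fourier_coeff (proj_plus u) k = fourier_coeff u k" for k
        using * by (cases "k \<le> 0") (auto simp: p(2) indicator_def)
    qed simp
    then have "AE x in lborel. proj_plus u x = u x"
      by (intro AE_circ_periodic Lp_circle_borel[OF u] Lp_circle_borel[OF p(1)]
          Lp_circle_periodic[OF u] Lp_circle_periodic[OF p(1)])
    then show "u \<in> W_plus" using True by (simp add: W_plus_def)
  qed
qed (simp add: W_plus_def)

lemma momentum_circ: "momentum u = (\<integral>x. (norm (u x))\<^sup>2 \<partial>circ)"
  by (simp add: momentum_def integral_circ)

definition half_symbol :: "int \<Rightarrow> complex" where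
  "half_symbol k = (2 * of_real pi * \<i> * of_int k) powr (- 1 / 2)"

lemma norm_half_symbol_le: "norm (half_symbol k) \<le> 1"
proof (cases "k = 0")
  case False
  let ?z = "2 * complex_of_real pi * \<i> * of_int k"
  have "1 \<le> \<bar>real_of_int k\<bar>" using False by linarith
  moreover have "1 \<le> 2 * pi" using pi_gt3 by simp
  ultimately have "1 * 1 \<le> 2 * pi * \<bar>real_of_int k\<bar>" by (intro mult_mono) auto
  then have "0 \<le> ln (norm ?z)" by (simp add: norm_mult)
  then show ?thesis using False by (simp add: half_symbol_def powr_def)
qed (simp add: half_symbol_def)

lemma half_symbol_nonzero: "k \<noteq> 0 \<Longrightarrow> half_symbol k \<noteq> 0"
  by (simp add: half_symbol_def powr_def)

lemma mass_tendsto: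
  assumes u: "u \<in> Lp_circle 2"
  shows "(\<lambda>N. 2 * pi * (\<Sum>k\<in>freqs N. (norm (half_symbol k))\<^sup>2 * (norm (fourier_coeff u k))\<^sup>2)) \<longlonglongrightarrow> mass u"
proof -
  have d: "deriv_neg_half u \<in> Lp_circle 2"
      "\<And>k. fourier_coeff (deriv_neg_half u) k = half_symbol k * fourier_coeff u k"
    unfolding deriv_neg_half_def half_symbol_def[symmetric] by (intro fourier_multiplier_spec u norm_half_symbol_le)+
  show ?thesis
    using Parseval[OF d(1)]
    by (simp add: d(2) norm_mult power_mult_distrib mass_def integral_circ)
qed

lemma mass_le_momentum:
  assumes u: "u \<in> Lp_circle 2"
  shows "mass u \<le> momentum u"
proof -
  have "(\<lambda>N. 2 * pi * (\<Sum>k\<in>freqs N. (norm (fourier_coeff u k))\<^sup>2)) \<longlonglongrightarrow> momentum u"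
    unfolding momentum_circ by (rule Parseval[OF u])
  then show ?thesis
  proof (rule LIMSEQ_le[OF mass_tendsto[OF u]], intro exI allI impI)
    fix N :: nat
    show "2 * pi * (\<Sum>k\<in>freqs N. (norm (half_symbol k))\<^sup>2 * (norm (fourier_coeff u k))\<^sup>2)
        \<le> 2 * pi * (\<Sum>k\<in>freqs N. (norm (fourier_coeff u k))\<^sup>2)"
      by (intro mult_left_mono sum_mono mult_left_le_one_le power_le_one norm_half_symbol_le) auto
  qed
qed

lemma mass_nonneg: "mass u \<ge> 0"
  by (simp add: mass_def integral_circ)

lemma mass_cmult:
  assumes u: "u \<in> Lp_circle 2"
  shows "mass (\<lambda>x. c * u x) = (norm c)\<^sup>2 * mass u"
proof -
  have "(\<lambda>N. (norm c)\<^sup>2 * (2 * pi * (\<Sum>k\<in>freqs N. (norm (half_symbol k))\<^sup>2 * (norm (fourier_coeff u k))\<^sup>2)))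
      \<longlonglongrightarrow> (norm c)\<^sup>2 * mass u"
    by (intro tendsto_intros mass_tendsto u)
  moreover have "(norm c)\<^sup>2 * (2 * pi * (\<Sum>k\<in>freqs N. (norm (half_symbol k))\<^sup>2 * (norm (fourier_coeff u k))\<^sup>2))
     = 2 * pi * (\<Sum>k\<in>freqs N. (norm (half_symbol k))\<^sup>2 * (norm (fourier_coeff (\<lambda>x. c * u x) k))\<^sup>2)" for N
    by (simp add: fourier_coeff_cmult norm_mult power_mult_distrib sum_distrib_left mult_ac)
  ultimately show ?thesis
    using LIMSEQ_unique[OF mass_tendsto[OF Lp_circle_cmult[OF u, of c]]] by simp
qed

text \<open>
  The mass is the square of a Hilbert seminorm, and this is Young's form of its triangle
  inequality. It holds for each coefficient separately, so it passes to the limit of the partial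
  sums without a Cauchy-Schwarz inequality for series.
\<close>

lemma mass_quasi_triangle:
  assumes u: "u \<in> Lp_circle 2" and v: "v \<in> Lp_circle 2" and e: "e > 0"
  shows "mass u \<le> (1 + e) * mass v + (1 + 1 / e) * mass (\<lambda>x. u x - v x)"
proof (rule LIMSEQ_le[OF mass_tendsto[OF u]])
  let ?S = "\<lambda>u N. 2 * pi * (\<Sum>k\<in>freqs N. (norm (half_symbol k))\<^sup>2 * (norm (fourier_coeff u k))\<^sup>2)"
  show "(\<lambda>N. (1 + e) * ?S v N + (1 + 1 / e) * ?S (\<lambda>x. u x - v x) N)
      \<longlonglongrightarrow> (1 + e) * mass v + (1 + 1 / e) * mass (\<lambda>x. u x - v x)"
    by (intro tendsto_intros mass_tendsto v Lp_circle_diff[OF u v])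
  have sq: "(norm a)\<^sup>2 \<le> (1 + e) * (norm b)\<^sup>2 + (1 + 1 / e) * (norm (a - b))\<^sup>2" for a b :: complex
  proof -
    have "norm a \<le> norm b + norm (a - b)" using norm_triangle_ineq[of b "a - b"] by simp
    then have "(norm a)\<^sup>2 \<le> (norm b + norm (a - b))\<^sup>2" by (intro power_mono) auto
    also have "\<dots> = (1 + e) * (norm b)\<^sup>2 + (1 + 1 / e) * (norm (a - b))\<^sup>2 - (e * norm b - norm (a - b))\<^sup>2 / e"
      using e by (simp add: field_simps power2_eq_square)
    also have "\<dots> \<le> (1 + e) * (norm b)\<^sup>2 + (1 + 1 / e) * (norm (a - b))\<^sup>2"
      using e by simp
    finally show ?thesis .
  qed
  have dif: "fourier_coeff (\<lambda>x. u x - v x) k = fourier_coeff u k - fourier_coeff v k" for k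
    by (intro fourier_coeff_diff Lp_circle_integrable_self[OF u] Lp_circle_integrable_self[OF v]) auto
  have "?S u N \<le> (1 + e) * ?S v N + (1 + 1 / e) * ?S (\<lambda>x. u x - v x) N" for N
  proof -
    have "?S u N \<le> 2 * pi * (\<Sum>k\<in>freqs N. (norm (half_symbol k))\<^sup>2 *
        ((1 + e) * (norm (fourier_coeff v k))\<^sup>2 + (1 + 1 / e) * (norm (fourier_coeff u k - fourier_coeff v k))\<^sup>2))"
      by (intro mult_left_mono sum_mono sq) auto
    also have "\<dots> = (1 + e) * ?S v N + (1 + 1 / e) * ?S (\<lambda>x. u x - v x) N"
      unfolding dif by (simp add: sum.distrib sum_distrib_left distrib_left mult_ac)
    finally show ?thesis .
  qed
  then show "\<exists>N0. \<forall>N\<ge>N0. ?S u N \<le> (1 + e) * ?S v N + (1 + 1 / e) * ?S (\<lambda>x. u x - v x) N" by blast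
qed

text \<open>Since the mass of \<open>u n - v\<close> is bounded by its momentum, it tends to zero.\<close>

lemma mass_continuous:
  assumes u: "\<And>n. u n \<in> Lp_circle 2" and v: "v \<in> Lp_circle 2"
    and conv: "(\<lambda>n. \<integral>x. (norm (u n x - v x))\<^sup>2 \<partial>circ) \<longlonglongrightarrow> 0"
  shows "(\<lambda>n. mass (u n)) \<longlonglongrightarrow> mass v"
proof -
  define d where "d = (\<lambda>n. mass (\<lambda>x. u n x - v x))"
  have d0: "d \<longlonglongrightarrow> 0"
  proof (rule Lim_null_comparison[OF _ conv])
    show "\<forall>\<^sub>F n in sequentially. norm (d n) \<le> (\<integral>x. (norm (u n x - v x))\<^sup>2 \<partial>circ)"
      using mass_le_momentum[OF Lp_circle_diff[OF u v]] mass_nonneg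
      by (auto simp: d_def momentum_circ)
  qed
  have up: "mass (u n) \<le> (1 + e) * mass v + (1 + 1 / e) * d n"
    and lo: "mass v \<le> (1 + e) * mass (u n) + (1 + 1 / e) * d n" if "e > 0" for e n
  proof -
    show "mass (u n) \<le> (1 + e) * mass v + (1 + 1 / e) * d n"
      unfolding d_def by (rule mass_quasi_triangle[OF u v that])
    have "mass (\<lambda>x. v x - u n x) = d n"
      using mass_cmult[OF Lp_circle_diff[OF u[of n] v], of "-1"] by (simp add: d_def)
    then show "mass v \<le> (1 + e) * mass (u n) + (1 + 1 / e) * d n"
      using mass_quasi_triangle[OF v u[of n] that] by simp
  qed
  show ?thesis
  proof (rule LIMSEQ_I)
    fix r :: real assume r: "r > 0"
    \<comment> \<open>Fixed before \<open>n\<close>, so that the large weight \<open>1 + 1 / e\<close> is absorbed by \<open>d n \<longlonglongrightarrow> 0\<close>.\<close>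
    define e where "e = min 1 (r / (8 * (mass v + 1)))"
    have e: "e > 0" "e \<le> 1" and em: "e * mass v \<le> r / 8"
    proof -
      show "e > 0" "e \<le> 1" using r mass_nonneg[of v] by (auto simp: e_def)
      have "e * mass v \<le> r / (8 * (mass v + 1)) * mass v"
        using mass_nonneg[of v] by (intro mult_right_mono) (auto simp: e_def)
      also have "\<dots> \<le> r / 8" using r mass_nonneg[of v] by (simp add: field_simps)
      finally show "e * mass v \<le> r / 8" .
    qed
    have "(\<lambda>n. (1 + 1 / e) * d n) \<longlonglongrightarrow> (1 + 1 / e) * 0" by (intro tendsto_intros d0)
    then obtain N where N: "\<And>n. n \<ge> N \<Longrightarrow> \<bar>(1 + 1 / e) * d n\<bar> < r / 8"
      using LIMSEQ_D[of "\<lambda>n. (1 + 1 / e) * d n" 0 "r / 8"] r by auto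
    have "norm (mass (u n) - mass v) < r" if "n \<ge> N" for n
    proof -
      let ?t = "(1 + 1 / e) * d n"
      have 1: "mass (u n) - mass v \<le> r / 8 + r / 8"
        using up[OF e(1), of n] N[OF that] em distrib_right[of 1 e "mass v"] by linarith
      have "mass v - mass (u n) \<le> e * mass (u n) + r / 8"
        using lo[OF e(1), of n] N[OF that] distrib_right[of 1 e "mass (u n)"] by linarith
      also have "e * mass (u n) \<le> e * (mass v + r / 4)"
        using 1 e by (intro mult_left_mono) auto
      also have "\<dots> \<le> r / 8 + r / 4"
        using em mult_right_mono[OF e(2), of "r / 4"] r distrib_left[of e "mass v" "r / 4"] by linarith
      finally show ?thesis using 1 r by auto
    qed
    then show "\<exists>N. \<forall>n\<ge>N. norm (mass (u n) - mass v) < r" by blast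
  qed
qed

text \<open>
  The symbol of the multiplier vanishes only at frequency \<open>0\<close>, which is excluded in \<open>W_plus\<close>.
\<close>

lemma mass_eq_0_imp_AE_zero:
  assumes u: "u \<in> W_plus" and "mass u = 0"
  shows "AE x in circ. u x = 0"
proof -
  have u4: "u \<in> Lp_circle 4" and neg: "\<And>k. k \<le> 0 \<Longrightarrow> fourier_coeff u k = 0"
    using u by (auto simp: W_plus_iff W_quarter_4_def)
  have u2: "u \<in> Lp_circle 2" using Lp_circle_mono[OF u4] by simp
  have "fourier_coeff u j = 0" for j
  proof (cases "j \<le> 0")
    case False
    let ?S = "\<lambda>N. 2 * pi * (\<Sum>k\<in>freqs N. (norm (half_symbol k))\<^sup>2 * (norm (fourier_coeff u k))\<^sup>2)"
    have "2 * pi * ((norm (half_symbol j))\<^sup>2 * (norm (fourier_coeff u j))\<^sup>2) \<le> mass u"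
    proof (rule LIMSEQ_le_const[OF mass_tendsto[OF u2]])
      have "2 * pi * ((norm (half_symbol j))\<^sup>2 * (norm (fourier_coeff u j))\<^sup>2) \<le> ?S N" if "N \<ge> nat j" for N
        using that False by (intro mult_left_mono member_le_sum) auto
      then show "\<exists>N0. \<forall>N\<ge>N0. 2 * pi * ((norm (half_symbol j))\<^sup>2 * (norm (fourier_coeff u j))\<^sup>2) \<le> ?S N"
        by blast
    qed
    then have "(norm (half_symbol j))\<^sup>2 * (norm (fourier_coeff u j))\<^sup>2 \<le> 0"
      using \<open>mass u = 0\<close> pi_gt_zero by (auto simp: mult_le_0_iff simp del: pi_gt_zero)
    then show ?thesis
      using half_symbol_nonzero[of j] False by (auto simp: mult_le_0_iff)
  qed (use neg in simp)
  then have "vanishing_coeffs u"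
    using Lp_circle_integrable_self[OF u4] by (simp add: vanishing_coeffs_def)
  then show ?thesis by (rule vanishing_coeffs_imp_zero[OF _ Lp_circle_borel[OF u4]])
qed

section \<open>The Gagliardo energy and compactness\<close>

definition gag_kernel :: "(real \<Rightarrow> complex) \<Rightarrow> real \<Rightarrow> real \<Rightarrow> real" where
  "gag_kernel u x y = norm (u x - u y) ^ 4 / (1 - cos (x - y))"

lemma gag_kernel_nonneg [simp]: "gag_kernel u x y \<ge> 0"
  by (simp add: gag_kernel_def)

lemma gag_kernel_measurable [measurable]:
  assumes [measurable]: "u \<in> borel_measurable borel"
  shows "(\<lambda>(x, y). gag_kernel u x y) \<in> borel_measurable (circ \<Otimes>\<^sub>M circ)"
  unfolding gag_kernel_def by measurable

lemma gag_kernel_measurable2 [measurable]: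
  assumes [measurable]: "u \<in> borel_measurable borel"
  shows "gag_kernel u x \<in> borel_measurable circ"
  unfolding gag_kernel_def by measurable

lemma gagliardo_circ: "gagliardo u = (\<integral>\<^sup>+x. \<integral>\<^sup>+y. gag_kernel u x y \<partial>circ \<partial>circ)"
  unfolding gagliardo_def gag_kernel_def nn_integral_circ ..

lemma gagliardo_diff_le:
  assumes [measurable]: "u \<in> borel_measurable borel" "v \<in> borel_measurable borel"
  shows "gagliardo (\<lambda>x. u x - v x) \<le> 16 * (gagliardo u + gagliardo v)"
proof -
  have pt: "ennreal (gag_kernel (\<lambda>x. u x - v x) x y) \<le> 16 * (ennreal (gag_kernel u x y) + ennreal (gag_kernel v x y))" for x y
  proof -
    have "norm ((u x - v x) - (u y - v y)) ^ 4 \<le> 2 ^ 4 * (norm (u x - u y) ^ 4 + norm (v x - v y) ^ 4)"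
      using norm_diff_power_le[of "u x - u y" "v x - v y" 4] by (simp add: algebra_simps)
    then have "gag_kernel (\<lambda>x. u x - v x) x y \<le> 16 * (gag_kernel u x y + gag_kernel v x y)"
      unfolding gag_kernel_def add_divide_distrib[symmetric] times_divide_eq_right
      by (intro divide_right_mono) auto
    then have "ennreal (gag_kernel (\<lambda>x. u x - v x) x y) \<le> ennreal (16 * (gag_kernel u x y + gag_kernel v x y))"
      by (rule ennreal_leI)
    also have "\<dots> = 16 * (ennreal (gag_kernel u x y) + ennreal (gag_kernel v x y))"
      by (simp add: ennreal_mult' ennreal_plus)
    finally show ?thesis .
  qed
  have "gagliardo (\<lambda>x. u x - v x)
      \<le> (\<integral>\<^sup>+x. \<integral>\<^sup>+y. 16 * (ennreal (gag_kernel u x y) + ennreal (gag_kernel v x y)) \<partial>circ \<partial>circ)"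
    unfolding gagliardo_circ by (intro nn_integral_mono pt)
  also have "\<dots> = (\<integral>\<^sup>+x. 16 * ((\<integral>\<^sup>+y. gag_kernel u x y \<partial>circ) + (\<integral>\<^sup>+y. gag_kernel v x y \<partial>circ)) \<partial>circ)"
    by (intro nn_integral_cong) (simp add: nn_integral_cmult nn_integral_add)
  also have "\<dots> = 16 * (gagliardo u + gagliardo v)"
    unfolding gagliardo_circ by (simp add: nn_integral_cmult nn_integral_add)
  finally show ?thesis .
qed

lemma gagliardo_cmult:
  assumes [measurable]: "u \<in> borel_measurable borel"
  shows "gagliardo (\<lambda>x. c * u x) = ennreal (norm c ^ 4) * gagliardo u"
proof -
  have "gag_kernel (\<lambda>x. c * u x) x y = norm c ^ 4 * gag_kernel u x y" for x y
    by (simp add: gag_kernel_def right_diff_distrib[symmetric] norm_mult power_mult_distrib)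
  then show ?thesis
    unfolding gagliardo_circ by (simp add: ennreal_mult nn_integral_cmult)
qed

lemma gagliardo_Fatou:
  assumes [measurable]: "\<And>n. u n \<in> borel_measurable borel" "v \<in> borel_measurable borel"
    and lim: "AE x in circ. (\<lambda>n. u n x) \<longlonglongrightarrow> v x"
  shows "gagliardo v \<le> liminf (\<lambda>n. gagliardo (u n))"
proof -
  have "gagliardo v = (\<integral>\<^sup>+x. \<integral>\<^sup>+y. liminf (\<lambda>n. ennreal (gag_kernel (u n) x y)) \<partial>circ \<partial>circ)"
    unfolding gagliardo_circ
  proof (rule nn_integral_cong_AE)
    show "AE x in circ. (\<integral>\<^sup>+y. gag_kernel v x y \<partial>circ) = (\<integral>\<^sup>+y. liminf (\<lambda>n. ennreal (gag_kernel (u n) x y)) \<partial>circ)"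
      using lim
    proof eventually_elim
      fix x assume x: "(\<lambda>n. u n x) \<longlonglongrightarrow> v x"
      show "(\<integral>\<^sup>+y. gag_kernel v x y \<partial>circ) = (\<integral>\<^sup>+y. liminf (\<lambda>n. ennreal (gag_kernel (u n) x y)) \<partial>circ)"
      proof (rule nn_integral_cong_AE)
        show "AE y in circ. ennreal (gag_kernel v x y) = liminf (\<lambda>n. ennreal (gag_kernel (u n) x y))"
          using lim
        proof eventually_elim
          fix y assume y: "(\<lambda>n. u n y) \<longlonglongrightarrow> v y"
          have "(\<lambda>n. gag_kernel (u n) x y) \<longlonglongrightarrow> gag_kernel v x y"
            unfolding gag_kernel_def divide_inverse by (intro tendsto_intros x y)
          then have "(\<lambda>n. ennreal (gag_kernel (u n) x y)) \<longlonglongrightarrow> ennreal (gag_kernel v x y)"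
            by (rule tendsto_ennrealI)
          from lim_imp_Liminf[OF _ this]
          show "ennreal (gag_kernel v x y) = liminf (\<lambda>n. ennreal (gag_kernel (u n) x y))" by simp
        qed
      qed
    qed
  qed
  also have "\<dots> \<le> (\<integral>\<^sup>+x. liminf (\<lambda>n. \<integral>\<^sup>+y. gag_kernel (u n) x y \<partial>circ) \<partial>circ)"
    by (intro nn_integral_mono nn_integral_liminf) measurable
  also have "\<dots> \<le> liminf (\<lambda>n. gagliardo (u n))"
    unfolding gagliardo_circ by (intro nn_integral_liminf) measurable
  finally show ?thesis .
qed

lemma one_minus_cos_le: "1 - cos t \<le> t\<^sup>2 / 2" for t :: real
proof -
  have "1 - cos t = 2 * (sin (t / 2))\<^sup>2"
    using cos_double_sin[of "t / 2"] by simp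
  also have "(sin (t / 2))\<^sup>2 \<le> (t / 2)\<^sup>2"
    using abs_sin_x_le_abs_x[of "t / 2"] by (simp only: abs_le_square_iff)
  finally show ?thesis by (simp add: power2_eq_square)
qed

text \<open>
  The convexity of the fourth power, as the tangent line at \<open>a\<close>; integrated with \<open>a\<close> the mean of
  \<open>t\<close>, it is Jensen's inequality.
\<close>

lemma fourth_power_tangent:
  fixes t a :: real
  assumes "0 \<le> t" "0 \<le> a"
  shows "a ^ 4 + 4 * a ^ 3 * (t - a) \<le> t ^ 4"
proof -
  have "t ^ 4 - (a ^ 4 + 4 * a ^ 3 * (t - a)) = (t - a)\<^sup>2 * (t\<^sup>2 + 2 * a * t + 3 * a\<^sup>2)"
    by (simp add: power2_eq_square power3_eq_cube power4_eq_xxxx algebra_simps)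
  also have "\<dots> \<ge> 0" using assms by (intro mult_nonneg_nonneg add_nonneg_nonneg) auto
  finally show ?thesis by simp
qed

definition mean :: "real \<Rightarrow> real \<Rightarrow> (real \<Rightarrow> complex) \<Rightarrow> complex" where
  "mean a b w = (\<integral>y. indicator {a..b} y *\<^sub>R w y \<partial>circ) / (b - a)"

lemma integrable_indicator_circ:
  fixes f :: "real \<Rightarrow> 'b::{banach, second_countable_topology}"
  assumes "integrable circ f"
  shows "integrable circ (\<lambda>y. indicator {a..b} y *\<^sub>R f y)"
proof (rule Bochner_Integration.integrable_bound[OF assms])
  have [measurable]: "f \<in> borel_measurable circ" using assms by simp
  have [measurable]: "(indicator {a..b} :: real \<Rightarrow> real) \<in> borel_measurable circ"
    by (intro borel_measurable_circ) simp
  show "(\<lambda>y. indicator {a..b} y *\<^sub>R f y) \<in> borel_measurable circ" by measurable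
qed (auto simp: indicator_def)

lemma integral_indicator_circ:
  assumes "0 \<le> a" "a \<le> b" "b \<le> 2 * pi"
  shows "(\<integral>y. indicator {a..b} y \<partial>circ) = b - a"
proof -
  have "(\<integral>y. indicator {a..b} y \<partial>circ) = (LINT y:{0..2*pi}|lborel. indicator {a..b} y :: real)"
    by (rule integral_circ[symmetric])
  also have "\<dots> = (\<integral>y. indicator {0..2*pi} y * indicator {a..b} y \<partial>lborel)"
    unfolding set_lebesgue_integral_def real_scaleR_def ..
  also have "(\<lambda>y::real. indicator {0..2*pi} y * indicator {a..b} y :: real) = indicator {a..b}"
    using assms by (auto simp: indicator_def fun_eq_iff)
  finally show ?thesis using assms by simp
qed

text \<open>
  A Poincare inequality before integration in \<open>x\<close>: on an interval of length \<open>l\<close> the denominator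
  \<open>1 - cos (x - y)\<close> is at most \<open>l\<^sup>2 / 2\<close>, and Jensen's inequality for the mean in \<open>y\<close> produces a
  factor \<open>1 / l\<close>. On an interval shorter than the period the denominator vanishes only where \<open>x = y\<close>,
  and there the numerator vanishes as well.
\<close>

lemma norm_diff_mean_le:
  assumes w: "w \<in> Lp_circle 4" and ab: "0 \<le> a" "a < b" "b \<le> 2 * pi" "b - a < 2 * pi" and x: "x \<in> {a..b}"
  shows "ennreal (norm (w x - mean a b w) ^ 4) \<le> ennreal ((b - a) / 2) * (\<integral>\<^sup>+y. gag_kernel w x y \<partial>circ)"
proof -
  define l where "l = b - a"
  have l: "l > 0" using ab by (simp add: l_def)
  have [measurable]: "w \<in> borel_measurable borel" using w by (rule Lp_circle_borel)
  have wint: "integrable circ w" by (rule Lp_circle_integrable_self[OF w]) simp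
  let ?I = "indicator {a..b} :: real \<Rightarrow> real"
  have [measurable]: "?I \<in> borel_measurable circ" by (intro borel_measurable_circ) simp
  define g where "g = (\<lambda>y. norm (w x - w y))"
  have [measurable]: "g \<in> borel_measurable circ" unfolding g_def by measurable
  have g0: "g y \<ge> 0" for y by (simp add: g_def)
  have gint: "integrable circ g" unfolding g_def using wint by simp
  have g4: "integrable circ (\<lambda>y. g y ^ 4)"
    unfolding g_def by (intro integrable_norm_diff_power Lp_circle_integrable[OF w]) auto
  have I1: "(\<integral>y. ?I y \<partial>circ) = l" using ab integral_indicator_circ[of a b] by (simp add: l_def)
  have Iint: "integrable circ ?I" using integrable_indicator_circ[of "\<lambda>_. 1::real" a b] by simp
  define A where "A = (\<integral>y. ?I y * g y \<partial>circ) / l"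
  have A0: "A \<ge> 0" unfolding A_def using l g0 by (intro divide_nonneg_pos integral_nonneg) auto
  have gI: "integrable circ (\<lambda>y. ?I y * g y)" and g4I: "integrable circ (\<lambda>y. ?I y * g y ^ 4)"
    using integrable_indicator_circ[OF gint, of a b] integrable_indicator_circ[OF g4, of a b] by auto
  have "norm (w x - mean a b w) \<le> A"
  proof -
    have "w x - mean a b w = (\<integral>y. ?I y *\<^sub>R (w x - w y) \<partial>circ) / l"
    proof -
      have "(\<integral>y. ?I y *\<^sub>R (w x - w y) \<partial>circ) = (\<integral>y. ?I y *\<^sub>R w x \<partial>circ) - (\<integral>y. ?I y *\<^sub>R w y \<partial>circ)"
        unfolding scaleR_diff_right
        by (intro Bochner_Integration.integral_diff integrable_indicator_circ wint) simp
      also have "(\<integral>y. ?I y *\<^sub>R w x \<partial>circ) = l *\<^sub>R w x"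
        using Iint I1 by simp
      finally show ?thesis
        using l by (simp add: mean_def l_def[symmetric] diff_divide_distrib scaleR_conv_of_real)
    qed
    then have "norm (w x - mean a b w) = norm (\<integral>y. ?I y *\<^sub>R (w x - w y) \<partial>circ) / l"
      using l by (simp add: norm_divide)
    also have "\<dots> \<le> (\<integral>y. norm (?I y *\<^sub>R (w x - w y)) \<partial>circ) / l"
      using l by (intro divide_right_mono integral_norm_bound) auto
    finally show ?thesis by (simp add: A_def g_def)
  qed
  then have "norm (w x - mean a b w) ^ 4 \<le> A ^ 4" by (intro power_mono) auto
  also have "A ^ 4 \<le> (\<integral>y. ?I y * g y ^ 4 \<partial>circ) / l"
  proof -
    have "(\<integral>y. ?I y * (A ^ 4 + 4 * A ^ 3 * (g y - A)) \<partial>circ) \<le> (\<integral>y. ?I y * g y ^ 4 \<partial>circ)"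
    proof (rule integral_mono)
      show "integrable circ (\<lambda>y. ?I y * (A ^ 4 + 4 * A ^ 3 * (g y - A)))"
        using integrable_indicator_circ[of "\<lambda>y. A ^ 4 + 4 * A ^ 3 * (g y - A)" a b] gint by simp
      show "?I y * (A ^ 4 + 4 * A ^ 3 * (g y - A)) \<le> ?I y * g y ^ 4" for y
        by (intro mult_left_mono fourth_power_tangent g0 A0) auto
    qed (rule g4I)
    moreover have "(\<integral>y. ?I y * (A ^ 4 + 4 * A ^ 3 * (g y - A)) \<partial>circ)
        = (\<integral>y. (A ^ 4 - 4 * A ^ 3 * A) * ?I y + 4 * A ^ 3 * (?I y * g y) \<partial>circ)"
      by (intro Bochner_Integration.integral_cong) (auto simp: algebra_simps)
    moreover have "\<dots> = (A ^ 4 - 4 * A ^ 3 * A) * l + 4 * A ^ 3 * (A * l)"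
      using Iint gI l I1 by (simp add: A_def)
    ultimately have "A ^ 4 * l \<le> (\<integral>y. ?I y * g y ^ 4 \<partial>circ)"
      by (simp add: algebra_simps)
    then show ?thesis using l by (simp add: pos_le_divide_eq)
  qed
  finally have "ennreal (norm (w x - mean a b w) ^ 4) \<le> ennreal ((1 / l) * (\<integral>y. ?I y * g y ^ 4 \<partial>circ))"
    by (intro ennreal_leI) simp
  also have "\<dots> = ennreal (1 / l) * ennreal (\<integral>y. ?I y * g y ^ 4 \<partial>circ)"
    using l g0 by (intro ennreal_mult integral_nonneg) auto
  also have "ennreal (\<integral>y. ?I y * g y ^ 4 \<partial>circ) = (\<integral>\<^sup>+y. ?I y * g y ^ 4 \<partial>circ)"
    using g4I g0 by (intro nn_integral_eq_integral[symmetric]) auto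
  also have "\<dots> \<le> (\<integral>\<^sup>+y. ennreal (l\<^sup>2 / 2) * gag_kernel w x y \<partial>circ)"
  proof (rule nn_integral_mono)
    fix y
    have "?I y * g y ^ 4 \<le> l\<^sup>2 / 2 * gag_kernel w x y"
    proof (cases "y \<in> {a..b}")
      case True
      have "(x - y)\<^sup>2 \<le> l\<^sup>2"
        using True x by (auto simp: l_def abs_le_square_iff[symmetric])
      then have c: "1 - cos (x - y) \<le> l\<^sup>2 / 2"
        using one_minus_cos_le[of "x - y"] by linarith
      show ?thesis
      proof (cases "1 - cos (x - y) = 0")
        case zero: True
        then obtain n :: int where n: "x - y = of_int n * (2 * pi)"
          using cos_one_2pi_int[of "x - y"] by auto
        have "\<bar>of_int n * (2 * pi)\<bar> < 2 * pi" using n True x ab(4) by auto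
        then have "\<bar>real_of_int n\<bar> < 1" by (simp add: abs_mult)
        then have "n = 0" by linarith
        then have "x = y" using n by simp
        then show ?thesis by (simp add: g_def)
      next
        case False
        then have pos: "1 - cos (x - y) > 0" using cos_le_one[of "x - y"] by linarith
        have gk: "gag_kernel w x y = g y ^ 4 / (1 - cos (x - y))"
          by (simp add: gag_kernel_def g_def)
        have "g y ^ 4 * (1 - cos (x - y)) \<le> g y ^ 4 * (l\<^sup>2 / 2)"
          using c g0 by (intro mult_left_mono) auto
        then have "g y ^ 4 \<le> g y ^ 4 * (l\<^sup>2 / 2) / (1 - cos (x - y))"
          using pos by (simp only: pos_le_divide_eq)
        then show ?thesis
          using True gk by (simp add: mult_ac)
      qed
    qed simp
    then show "ennreal (?I y * g y ^ 4) \<le> ennreal (l\<^sup>2 / 2) * ennreal (gag_kernel w x y)"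
      by (simp add: ennreal_mult[symmetric] ennreal_leI)
  qed
  also have "\<dots> = ennreal (l\<^sup>2 / 2) * (\<integral>\<^sup>+y. gag_kernel w x y \<partial>circ)"
    by (rule nn_integral_cmult) measurable
  finally have "ennreal (norm (w x - mean a b w) ^ 4)
      \<le> ennreal (1 / l) * (ennreal (l\<^sup>2 / 2) * (\<integral>\<^sup>+y. gag_kernel w x y \<partial>circ))"
    by (simp add: mult_left_mono)
  also have "\<dots> = ennreal (1 / l * (l\<^sup>2 / 2)) * (\<integral>\<^sup>+y. gag_kernel w x y \<partial>circ)"
    using l by (subst ennreal_mult) (auto simp: mult.assoc)
  also have "1 / l * (l\<^sup>2 / 2) = (b - a) / 2"
    using l by (simp add: l_def[symmetric] power2_eq_square)
  finally show ?thesis .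
qed

definition grid_mean :: "nat \<Rightarrow> nat \<Rightarrow> (real \<Rightarrow> complex) \<Rightarrow> complex" where
  "grid_mean N j = mean (2 * pi * j / N) (2 * pi * (j + 1) / N)"

text \<open>
  A function of bounded Gagliardo integral is controlled in \<open>L\<^sup>4\<close> by finitely many numbers, up to an
  error that vanishes as the grid is refined. The bound is obtained for each \<open>x\<close> in its grid cell
  and then integrated over the whole circle, which makes a sum over the cells superfluous.
\<close>

lemma integral_fourth_power_le:
  assumes w: "w \<in> Lp_circle 4" and N: "N \<ge> 2"
    and \<delta>: "\<And>j. j < N \<Longrightarrow> norm (grid_mean N j w) ^ 4 \<le> \<delta>"
  shows "ennreal (\<integral>x. norm (w x) ^ 4 \<partial>circ) \<le> ennreal (16 * pi / N) * gagliardo w + ennreal (32 * pi * \<delta>)"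
proof -
  have [measurable]: "w \<in> borel_measurable borel" using w by (rule Lp_circle_borel)
  have \<delta>0: "\<delta> \<ge> 0" using \<delta>[of 0] N by (meson less_le_trans order_trans pos2 zero_le_power norm_ge_zero)
  have pt: "ennreal (norm (w x) ^ 4) \<le> ennreal (16 * pi / N) * (\<integral>\<^sup>+y. gag_kernel w x y \<partial>circ) + ennreal (16 * \<delta>)"
    if "x \<in> {0..2*pi}" for x
  proof -
    define t where "t = x * N / (2 * pi)"
    have t: "0 \<le> t" "t \<le> N" using that N by (auto simp: t_def field_simps)
    obtain j where j: "j < N" "real j \<le> t" "t \<le> real j + 1"
    proof (cases "t = N")
      case True
      then show ?thesis using that[of "N - 1"] N by (simp add: of_nat_diff)
    next
      case False
      then have "nat \<lfloor>t\<rfloor> < N" using t by linarith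
      then show ?thesis using that[of "nat \<lfloor>t\<rfloor>"] t by simp
    qed
    define a b where "a = 2 * pi * j / N" and "b = 2 * pi * (j + 1) / N"
    have xt: "x = 2 * pi * t / N" using N by (simp add: t_def)
    have ba: "b - a = 2 * pi / N" by (simp add: a_def b_def diff_divide_distrib[symmetric] algebra_simps)
    have x: "x \<in> {a..b}"
      unfolding xt a_def b_def using j N by (auto intro!: divide_right_mono mult_left_mono)
    have "b \<le> 2 * pi * N / N"
      unfolding b_def using j by (intro divide_right_mono mult_left_mono) auto
    then have ab: "0 \<le> a" "a < b" "b \<le> 2 * pi" "b - a < 2 * pi"
    proof -
      have "b - a > 0" unfolding ba using N by simp
      then show "a < b" by simp
      show "b - a < 2 * pi" unfolding ba using N by (simp add: field_simps)
    qed (use N in \<open>auto simp: a_def\<close>)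
    have "norm (w x) ^ 4 \<le> 2 ^ 4 * (norm (w x - mean a b w) ^ 4 + norm (mean a b w) ^ 4)"
      using norm_add_power_le[of "w x - mean a b w" "mean a b w" 4] by simp
    also have "\<dots> \<le> 16 * norm (w x - mean a b w) ^ 4 + 16 * \<delta>"
      using \<delta>[OF j(1)] by (simp add: grid_mean_def a_def b_def add.commute)
    finally have "ennreal (norm (w x) ^ 4) \<le> ennreal (16 * norm (w x - mean a b w) ^ 4 + 16 * \<delta>)"
      by (rule ennreal_leI)
    also have "\<dots> = 16 * ennreal (norm (w x - mean a b w) ^ 4) + ennreal (16 * \<delta>)"
      using \<delta>0 by (simp add: ennreal_plus ennreal_mult')
    also have "\<dots> \<le> 16 * (ennreal ((b - a) / 2) * (\<integral>\<^sup>+y. gag_kernel w x y \<partial>circ)) + ennreal (16 * \<delta>)"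
      by (intro add_right_mono mult_left_mono norm_diff_mean_le[OF w ab x]) simp
    also have "16 * (ennreal ((b - a) / 2) * (\<integral>\<^sup>+y. gag_kernel w x y \<partial>circ))
        = ennreal (16 * pi / N) * (\<integral>\<^sup>+y. gag_kernel w x y \<partial>circ)"
    proof -
      have "ennreal (16 * pi / N) = ennreal 16 * ennreal ((b - a) / 2)"
        unfolding ba by (subst ennreal_mult[symmetric]) (auto simp: field_simps)
      then show ?thesis by (simp add: mult.assoc)
    qed
    finally show ?thesis .
  qed
  have "ennreal (\<integral>x. norm (w x) ^ 4 \<partial>circ) = (\<integral>\<^sup>+x. norm (w x) ^ 4 \<partial>circ)"
    by (intro nn_integral_eq_integral[symmetric] Lp_circle_integrable[OF w]) auto
  also have "\<dots> \<le> (\<integral>\<^sup>+x. ennreal (16 * pi / N) * (\<integral>\<^sup>+y. gag_kernel w x y \<partial>circ) + ennreal (16 * \<delta>) \<partial>circ)"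
    by (intro nn_integral_mono pt) simp
  also have "\<dots> = ennreal (16 * pi / N) * gagliardo w + ennreal (16 * \<delta>) * ennreal (2 * pi)"
    unfolding gagliardo_circ by (simp add: nn_integral_add nn_integral_cmult)
  also have "ennreal (16 * \<delta>) * ennreal (2 * pi) = ennreal (32 * pi * \<delta>)"
    using \<delta>0 by (subst ennreal_mult[symmetric]) (auto simp: field_simps)
  finally show ?thesis .
qed

lemma grid_mean_diff:
  assumes "integrable circ u" "integrable circ v"
  shows "grid_mean N j (\<lambda>x. u x - v x) = grid_mean N j u - grid_mean N j v"
  using assms
  by (simp add: grid_mean_def mean_def scaleR_diff_right integrable_indicator_circ diff_divide_distrib)

text \<open>
  The integrals over all cells of all grids are countably many bounded sequences, so a diagonal
  subsequence makes them all converge.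
\<close>

lemma L4_Cauchy_subsequence:
  fixes u :: "nat \<Rightarrow> real \<Rightarrow> complex"
  assumes u: "\<And>n. u n \<in> Lp_circle 4"
    and C: "\<And>n. (\<integral>x. norm (u n x) ^ 4 \<partial>circ) \<le> C"
    and G: "\<And>n. gagliardo (u n) \<le> ennreal C"
  obtains r :: "nat \<Rightarrow> nat" where "strict_mono r"
    "\<And>e. e > 0 \<Longrightarrow> \<exists>n0. \<forall>m\<ge>n0. \<forall>n\<ge>n0. (\<integral>x. norm (u (r m) x - u (r n) x) ^ 4 \<partial>circ) < e"
proof -
  have C0: "C \<ge> 0" using C[of 0] by (rule order_trans[rotated]) simp
  have uint: "integrable circ (u n)" for n by (rule Lp_circle_integrable_self[OF u]) simp
  have [measurable]: "u n \<in> borel_measurable borel" for n using u by (rule Lp_circle_borel)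
  \<comment> \<open>Integrals rather than means, because their bound is the same for all grids.\<close>
  define F where "F = (\<lambda>n (N, j). \<integral>y. indicator {2 * pi * real j / real N .. 2 * pi * real (j + 1) / real N} y *\<^sub>R u n y \<partial>circ)"
  have "norm (F n s) \<le> 2 * pi + C" for n s
  proof -
    obtain N j where s: "s = (N, j)" by (cases s)
    have "norm (F n s) \<le> (\<integral>y. norm (indicator {2 * pi * real j / real N .. 2 * pi * real (j + 1) / real N} y *\<^sub>R u n y) \<partial>circ)"
      unfolding F_def s prod.case by (rule integral_norm_bound)
    also have "\<dots> \<le> (\<integral>y. 1 + norm (u n y) ^ 4 \<partial>circ)"
    proof (rule integral_mono)
      fix y
      have "norm (u n y) \<le> 1 + norm (u n y) ^ 4"
        using power_le_one_add_power[of "norm (u n y)" 1 4] by simp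
      then show "norm (indicator {2 * pi * real j / real N .. 2 * pi * real (j + 1) / real N} y *\<^sub>R u n y)
          \<le> 1 + norm (u n y) ^ 4"
        by (auto simp: indicator_def intro: add_nonneg_nonneg)
      show "integrable circ (\<lambda>y. norm (indicator {2 * pi * real j / real N .. 2 * pi * real (j + 1) / real N} y *\<^sub>R u n y))"
        by (intro integrable_norm integrable_indicator_circ uint)
      show "integrable circ (\<lambda>y. 1 + norm (u n y) ^ 4)"
        using Lp_circle_integrable[OF u[of n]] by simp
    qed
    also have "\<dots> = 2 * pi + (\<integral>y. norm (u n y) ^ 4 \<partial>circ)"
      using Lp_circle_integrable[OF u[of n]] by simp
    finally show ?thesis using C[of n] by simp
  qed
  then obtain r where r: "strict_mono r" and conv: "\<And>s. \<exists>l. (\<lambda>n. F (r n) s) \<longlonglongrightarrow> l"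
    by (rule function_convergent_subsequence[of "UNIV :: (nat \<times> nat) set" F "2 * pi + C", rotated]) auto
  have gm: "Cauchy (\<lambda>n. grid_mean N j (u (r n)))" for N j
  proof -
    obtain l where "(\<lambda>n. F (r n) (N, j)) \<longlonglongrightarrow> l" using conv by blast
    then have "convergent (\<lambda>n. grid_mean N j (u (r n)))"
      unfolding grid_mean_def mean_def F_def prod.case convergent_def divide_inverse
      by (intro exI) (rule tendsto_mult_right)
    then show ?thesis by (rule convergent_Cauchy)
  qed
  have "\<exists>n0. \<forall>m\<ge>n0. \<forall>n\<ge>n0. (\<integral>x. norm (u (r m) x - u (r n) x) ^ 4 \<partial>circ) < e" if e: "e > 0" for e
  proof -
    \<comment> \<open>\<open>gagliardo (u m - u n)\<close> is at most \<open>32 * C\<close>, so this makes the Gagliardo term at most \<open>e / 4\<close>.\<close>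
    obtain N0 :: nat where N0: "2048 * pi * C / e < real N0" using reals_Archimedean2 by blast
    define N where "N = max 2 N0"
    have N: "N \<ge> 2" and Nbig: "2048 * pi * C / e < real N" using N0 by (auto simp: N_def)
    have small: "16 * pi / N * (32 * C) \<le> e / 4"
      using Nbig N e by (simp add: field_simps)
    define \<delta> where "\<delta> = e / (128 * pi)"
    have \<delta>: "\<delta> > 0" using e by (simp add: \<delta>_def)
    have "\<forall>j. \<exists>n0. \<forall>m\<ge>n0. \<forall>n\<ge>n0. norm (grid_mean N j (u (r m)) - grid_mean N j (u (r n))) < min 1 \<delta>"
      using gm \<delta> unfolding Cauchy_def dist_norm by (meson min_less_iff_conj zero_less_one)
    then obtain n1 where n1: "\<And>j m n. m \<ge> n1 j \<Longrightarrow> n \<ge> n1 j \<Longrightarrow>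
        norm (grid_mean N j (u (r m)) - grid_mean N j (u (r n))) < min 1 \<delta>" by metis
    define n0 where "n0 = sum n1 {..<N}"
    have n0: "n1 j \<le> n0" if "j < N" for j unfolding n0_def using that by (intro member_le_sum) auto
    have "(\<integral>x. norm (u (r m) x - u (r n) x) ^ 4 \<partial>circ) < e" if mn: "m \<ge> n0" "n \<ge> n0" for m n
    proof -
      let ?w = "\<lambda>x. u (r m) x - u (r n) x"
      have means: "norm (grid_mean N j ?w) ^ 4 \<le> \<delta>" if "j < N" for j
      proof -
        have lt: "norm (grid_mean N j ?w) < min 1 \<delta>"
          using n1[of j m n] n0[OF that] mn uint by (simp add: grid_mean_diff)
        then have "norm (grid_mean N j ?w) ^ 4 \<le> norm (grid_mean N j ?w) ^ 1"
          by (intro power_decreasing) auto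
        then show ?thesis using lt by simp
      qed
      have "gagliardo ?w \<le> 16 * (gagliardo (u (r m)) + gagliardo (u (r n)))"
        by (rule gagliardo_diff_le) measurable
      also have "\<dots> \<le> 16 * (ennreal C + ennreal C)"
        by (intro mult_left_mono add_mono G) simp
      also have "\<dots> = ennreal (32 * C)"
        using C0 by (simp add: ennreal_plus[symmetric] ennreal_mult' [symmetric] ennreal_numeral[symmetric] del: ennreal_plus ennreal_numeral)
      finally have gw: "gagliardo ?w \<le> ennreal (32 * C)" .
      have "ennreal (\<integral>x. norm (?w x) ^ 4 \<partial>circ) \<le> ennreal (16 * pi / N) * gagliardo ?w + ennreal (32 * pi * \<delta>)"
        by (rule integral_fourth_power_le[OF Lp_circle_diff[OF u u] N means])
      also have "\<dots> \<le> ennreal (16 * pi / N) * ennreal (32 * C) + ennreal (32 * pi * \<delta>)"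
        by (intro add_right_mono mult_left_mono gw) simp
      also have "\<dots> = ennreal (16 * pi / N * (32 * C) + 32 * pi * \<delta>)"
        using C0 \<delta> by (subst ennreal_mult[symmetric], simp_all add: ennreal_plus)
      also have "\<dots> \<le> ennreal (e / 4 + e / 4)"
        using small by (intro ennreal_leI add_mono) (auto simp: \<delta>_def)
      finally have "(\<integral>x. norm (?w x) ^ 4 \<partial>circ) \<le> e / 4 + e / 4"
        using e by (subst (asm) ennreal_le_iff) auto
      then show ?thesis using e by simp
    qed
    then show ?thesis by blast
  qed
  from that[OF r this] show ?thesis .
qed

lemma W_plusD:
  assumes "u \<in> W_plus"
  shows "u \<in> Lp_circle 4" "u \<in> Lp_circle 2" "gagliardo u < \<infinity>" "u \<in> borel_measurable borel"
  using assms Lp_circle_mono[of u 4 2] Lp_circle_borel[of u 4]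
  by (auto simp: W_plus_def W_quarter_4_def)

text \<open>
  The third extraction only makes the Gagliardo integrals converge; their limit \<open>L\<close> may be strictly
  larger than the Gagliardo integral of the limit function, everything else is continuous.
\<close>

lemma W_plus_compact:
  fixes u :: "nat \<Rightarrow> real \<Rightarrow> complex"
  assumes u: "\<And>n. u n \<in> W_plus"
    and C: "\<And>n. (\<integral>x. norm (u n x) ^ 4 \<partial>circ) \<le> C"
    and G: "\<And>n. enn2real (gagliardo (u n)) \<le> C"
  obtains r :: "nat \<Rightarrow> nat" and v L where "strict_mono r" "v \<in> W_plus"
    "(\<lambda>n. enn2real (gagliardo (u (r n)))) \<longlonglongrightarrow> L" "enn2real (gagliardo v) \<le> L"
    "(\<lambda>n. \<integral>x. norm (u (r n) x) ^ 4 \<partial>circ) \<longlonglongrightarrow> (\<integral>x. norm (v x) ^ 4 \<partial>circ)"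
    "(\<lambda>n. momentum (u (r n))) \<longlonglongrightarrow> momentum v"
    "(\<lambda>n. mass (u (r n))) \<longlonglongrightarrow> mass v"
proof -
  have C0: "C \<ge> 0" using C[of 0] by (rule order_trans[rotated]) simp
  have Genn: "gagliardo (u n) = ennreal (enn2real (gagliardo (u n)))" for n
    using W_plusD(3)[OF u[of n]] by (simp add: less_top)
  have G': "gagliardo (u n) \<le> ennreal C" for n
    by (subst Genn) (intro ennreal_leI G)
  obtain r1 :: "nat \<Rightarrow> nat" where r1: "strict_mono r1" and cauchy:
    "\<And>e. e > 0 \<Longrightarrow> \<exists>n0. \<forall>m\<ge>n0. \<forall>n\<ge>n0. (\<integral>x. norm (u (r1 m) x - u (r1 n) x) ^ 4 \<partial>circ) < e"
    by (rule L4_Cauchy_subsequence[of u C, OF W_plusD(1)[OF u] C G']) blast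
  obtain r2 v where r2: "strict_mono r2" and v: "v \<in> Lp_circle 4"
    and ae: "AE x in circ. (\<lambda>k. u (r1 (r2 k)) x) \<longlonglongrightarrow> v x"
    and norms: "\<And>q. q \<le> 4 \<Longrightarrow> (\<lambda>k. \<integral>x. norm (u (r1 (r2 k)) x) ^ q \<partial>circ) \<longlonglongrightarrow> (\<integral>x. norm (v x) ^ q \<partial>circ)"
    and diffs: "\<And>q. 0 < q \<Longrightarrow> q \<le> 4 \<Longrightarrow> (\<lambda>k. \<integral>x. norm (u (r1 (r2 k)) x - v x) ^ q \<partial>circ) \<longlonglongrightarrow> 0"
    and coeffs: "\<And>j. (\<lambda>k. fourier_coeff (u (r1 (r2 k))) j) \<longlonglongrightarrow> fourier_coeff v j"
    by (rule Lp_circle_complete[of "\<lambda>n. u (r1 n)" 4, OF W_plusD(1)[OF u] _ cauchy]) auto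
  have v2: "v \<in> Lp_circle 2" using Lp_circle_mono[OF v] by simp
  have "bounded (range (\<lambda>k. enn2real (gagliardo (u (r1 (r2 k))))))"
    using G by (intro boundedI[of _ C]) auto
  then obtain L r3 where r3: "strict_mono r3"
    and L: "((\<lambda>k. enn2real (gagliardo (u (r1 (r2 k))))) \<circ> r3) \<longlonglongrightarrow> L"
    using bounded_imp_convergent_subsequence by blast
  define r where "r = r1 \<circ> r2 \<circ> r3"
  have r: "strict_mono r" unfolding r_def by (intro strict_mono_o r1 r2 r3)
  have sub: "(\<lambda>k. f (r k)) \<longlonglongrightarrow> l" if "(\<lambda>k. f (r1 (r2 k))) \<longlonglongrightarrow> l" for f :: "nat \<Rightarrow> real" and l
    using LIMSEQ_subseq_LIMSEQ[OF that r3] by (simp add: r_def o_def)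
  have L': "(\<lambda>n. enn2real (gagliardo (u (r n)))) \<longlonglongrightarrow> L" using L by (simp add: r_def o_def)
  have L0: "L \<ge> 0" by (rule LIMSEQ_le_const[OF L']) auto
  have ae': "AE x in circ. (\<lambda>k. u (r k) x) \<longlonglongrightarrow> v x"
    using ae
  proof eventually_elim
    fix x assume "(\<lambda>k. u (r1 (r2 k)) x) \<longlonglongrightarrow> v x"
    from LIMSEQ_subseq_LIMSEQ[OF this r3] show "(\<lambda>k. u (r k) x) \<longlonglongrightarrow> v x"
      by (simp add: r_def o_def)
  qed
  have "gagliardo v \<le> liminf (\<lambda>n. gagliardo (u (r n)))"
    by (rule gagliardo_Fatou[OF W_plusD(4)[OF u] Lp_circle_borel[OF v] ae'])
  also have "liminf (\<lambda>n. gagliardo (u (r n))) = ennreal L"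
  proof (rule lim_imp_Liminf)
    show "(\<lambda>n. gagliardo (u (r n))) \<longlonglongrightarrow> ennreal L"
      by (subst Genn) (intro tendsto_ennrealI L')
  qed simp
  finally have gv: "gagliardo v \<le> ennreal L" .
  have "fourier_coeff v j = 0" if "j \<le> 0" for j
  proof (rule LIMSEQ_unique[OF coeffs])
    have "fourier_coeff (u n) j = 0" for n using u[of n] that by (auto simp: W_plus_iff)
    then show "(\<lambda>k. fourier_coeff (u (r1 (r2 k))) j) \<longlonglongrightarrow> 0" by simp
  qed
  moreover have "v \<in> W_quarter_4"
    using v gv by (auto simp: W_quarter_4_def intro: le_less_trans)
  ultimately have vW: "v \<in> W_plus" by (simp add: W_plus_iff)
  have gv': "enn2real (gagliardo v) \<le> L"
    using enn2real_mono[OF gv] L0 by simp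
  have m4: "(\<lambda>n. \<integral>x. norm (u (r n) x) ^ 4 \<partial>circ) \<longlonglongrightarrow> (\<integral>x. norm (v x) ^ 4 \<partial>circ)"
    by (rule sub[of "\<lambda>n. \<integral>x. norm (u n x) ^ 4 \<partial>circ"]) (rule norms, simp)
  have m2: "(\<lambda>n. momentum (u (r n))) \<longlonglongrightarrow> momentum v"
    unfolding momentum_circ by (rule sub[of "\<lambda>n. \<integral>x. (norm (u n x))\<^sup>2 \<partial>circ"]) (rule norms, simp)
  have mm: "(\<lambda>n. mass (u (r n))) \<longlonglongrightarrow> mass v"
    by (rule sub[of "\<lambda>n. mass (u n)"]) (intro mass_continuous W_plusD(2)[OF u] v2 diffs; simp)
  show ?thesis by (rule that[OF r vW L' gv' m4 m2 mm])
qed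

section \<open>Coercivity and existence of minimizers\<close>

lemma energy_circ:
  "energy \<sigma> u = enn2real (gagliardo u) / (4 * pi\<^sup>2) - 2 * \<sigma> / pi * (\<integral>x. norm (u x) ^ 4 \<partial>circ)"
  by (simp add: energy_def integral_circ)

lemma W_plus_cmult:
  assumes u: "u \<in> W_plus"
  shows "(\<lambda>x. c * u x) \<in> W_plus"
  using u W_plusD[OF u] Lp_circle_cmult[of u 4 c]
  by (auto simp: W_plus_iff W_quarter_4_def gagliardo_cmult fourier_coeff_cmult ennreal_mult_less_top)

text \<open>
  Otherwise there would be functions of energy and mass bounded by constants with \<open>L\<^sup>4\<close> norm
  tending to infinity. Divided by their \<open>L\<^sup>4\<close> norms they subconverge to a function of mass zero,
  hence to zero, but of \<open>L\<^sup>4\<close> norm one.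
\<close>

lemma energy_coercive:
  assumes \<sigma>: "\<sigma> \<ge> 0"
  obtains K where "\<And>u. u \<in> W_plus \<Longrightarrow> mass u \<le> B \<Longrightarrow> energy \<sigma> u \<le> E \<Longrightarrow> (\<integral>x. norm (u x) ^ 4 \<partial>circ) \<le> K"
proof (rule ccontr)
  assume "\<not> thesis"
  then have "\<forall>K. \<exists>u. u \<in> W_plus \<and> mass u \<le> B \<and> energy \<sigma> u \<le> E \<and> K < (\<integral>x. norm (u x) ^ 4 \<partial>circ)"
    using that by (meson not_le)
  then have "\<forall>n::nat. \<exists>u. u \<in> W_plus \<and> mass u \<le> B \<and> energy \<sigma> u \<le> E \<and> real n + 1 < (\<integral>x. norm (u x) ^ 4 \<partial>circ)"
    by blast
  then obtain u where u: "\<And>n. u n \<in> W_plus" and mass: "\<And>n. mass (u n) \<le> B"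
    and energy: "\<And>n. energy \<sigma> (u n) \<le> E" and big: "\<And>n::nat. real n + 1 < (\<integral>x. norm (u n x) ^ 4 \<partial>circ)"
    by metis
  define s where "s = (\<lambda>n. \<integral>x. norm (u n x) ^ 4 \<partial>circ)"
  have sI: "(\<integral>x. norm (u n x) ^ 4 \<partial>circ) = s n" for n by (simp add: s_def)
  have s: "s n > real n + 1" for n using big by (simp add: s_def)
  then have s1: "s n > 1" for n using of_nat_0_le_iff[of n] by (smt (verit))
  define c where "c = (\<lambda>n. 1 / sqrt (sqrt (s n)))"
  have c0: "c n > 0" for n using s1[of n] by (simp add: c_def)
  have c2: "(c n)\<^sup>2 = 1 / sqrt (s n)" for n using s1[of n] by (simp add: c_def power_divide)
  have c4: "c n ^ 4 = 1 / s n" for n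
  proof -
    have "c n ^ 4 = ((c n)\<^sup>2)\<^sup>2" by simp
    then show ?thesis using s1[of n] by (simp only: c2) (simp add: power_divide)
  qed
  define v where "v = (\<lambda>n x. of_real (c n) * u n x)"
  define C where "C = max 1 (4 * pi\<^sup>2 * (\<bar>E\<bar> + 2 * \<sigma> / pi))"
  have vW: "v n \<in> W_plus" for n unfolding v_def by (rule W_plus_cmult[OF u])
  have v4: "(\<integral>x. norm (v n x) ^ 4 \<partial>circ) = 1" for n
    using s1[of n] c0[of n] by (simp add: v_def norm_mult power_mult_distrib c4 sI)
  have vG: "enn2real (gagliardo (v n)) \<le> C" for n
  proof -
    have "enn2real (gagliardo (v n)) = enn2real (gagliardo (u n)) / s n"
      unfolding v_def gagliardo_cmult[OF W_plusD(4)[OF u]]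
      using c0[of n] s1[of n] by (simp add: enn2real_mult c4 power_abs[symmetric])
    also have "enn2real (gagliardo (u n)) = 4 * pi\<^sup>2 * (energy \<sigma> (u n) + 2 * \<sigma> / pi * s n)"
      by (simp add: energy_circ sI field_simps)
    also have "\<dots> / s n = 4 * pi\<^sup>2 * (energy \<sigma> (u n) / s n + 2 * \<sigma> / pi)"
      using s1[of n] by (simp add: field_simps)
    also have "energy \<sigma> (u n) / s n \<le> \<bar>E\<bar> / 1"
      using s1[of n] energy[of n] by (intro frac_le) auto
    finally have "enn2real (gagliardo (v n)) \<le> 4 * pi\<^sup>2 * (\<bar>E\<bar> + 2 * \<sigma> / pi)"
      by (simp add: mult_left_mono)
    then show ?thesis by (simp add: C_def)
  qed
  have vmass: "mass (v n) \<le> \<bar>B\<bar> / sqrt (real n + 1)" for n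
  proof -
    have "mass (v n) = mass (u n) / sqrt (s n)"
      using c0[of n] c2[of n] by (simp add: v_def mass_cmult[OF W_plusD(2)[OF u]])
    also have "\<dots> \<le> \<bar>B\<bar> / sqrt (real n + 1)"
      using s[of n] mass[of n] by (intro frac_le) auto
    finally show ?thesis .
  qed
  have "1 \<le> C" by (simp add: C_def)
  then obtain r :: "nat \<Rightarrow> nat" and w where r: "strict_mono r" and w: "w \<in> W_plus"
    and w4: "(\<lambda>n. \<integral>x. norm (v (r n) x) ^ 4 \<partial>circ) \<longlonglongrightarrow> (\<integral>x. norm (w x) ^ 4 \<partial>circ)"
    and wm: "(\<lambda>n. mass (v (r n))) \<longlonglongrightarrow> mass w"
    by (rule_tac W_plus_compact[of v C, OF vW _ vG]) (auto simp: v4)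
  have "(\<integral>x. norm (w x) ^ 4 \<partial>circ) = 1"
    using LIMSEQ_unique[OF w4] by (simp add: v4)
  moreover have "(\<lambda>n. mass (v n)) \<longlonglongrightarrow> 0"
  proof (rule Lim_null_comparison)
    show "\<forall>\<^sub>F n in sequentially. norm (mass (v n)) \<le> \<bar>B\<bar> / sqrt (real n + 1)"
      using vmass mass_nonneg by simp
    show "(\<lambda>n. \<bar>B\<bar> / sqrt (real n + 1)) \<longlonglongrightarrow> 0"
    proof (rule real_tendsto_divide_at_top[OF tendsto_const])
      have "filterlim (\<lambda>n. real n + 1) at_top sequentially"
        by (rule filterlim_at_top_mono[OF filterlim_real_sequentially]) simp
      then show "filterlim (\<lambda>n. sqrt (real n + 1)) at_top sequentially"
        by (rule filterlim_compose[OF sqrt_at_top])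
    qed
  qed
  from LIMSEQ_subseq_LIMSEQ[OF this r] have "mass w = 0"
    using LIMSEQ_unique[OF wm] by (simp add: o_def)
  from mass_eq_0_imp_AE_zero[OF w this] have "(\<integral>x. norm (w x) ^ 4 \<partial>circ) = (\<integral>x. 0 \<partial>circ)"
    using W_plusD(4)[OF w] by (intro integral_cong_AE) (auto elim!: eventually_mono intro!: borel_measurable_circ)
  ultimately show False by simp
qed

text \<open>
  The constraint set is only required to be closed under convergence of mass and momentum inside
  \<open>W_plus\<close> and to have bounded mass, which covers each of the constraints and their conjunction. The
  infimum is not known to be finite at the outset; that its minimizing sequence has energy bounded
  above is all that coercivity needs, and finiteness follows from the limit.
\<close>

theorem inf_energy_attainedI:
  assumes \<sigma>: "\<sigma> \<ge> 0" and A: "A \<subseteq> W_plus" "A \<noteq> {}" and B: "\<And>u. u \<in> A \<Longrightarrow> mass u \<le> B"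
    and closed: "\<And>u v. (\<And>n::nat. u n \<in> A) \<Longrightarrow> v \<in> W_plus \<Longrightarrow> (\<lambda>n. mass (u n)) \<longlonglongrightarrow> mass v \<Longrightarrow>
      (\<lambda>n. momentum (u n)) \<longlonglongrightarrow> momentum v \<Longrightarrow> v \<in> A"
  shows "inf_energy_attained \<sigma> A"
proof -
  define J where "J = (\<lambda>u. ereal (energy \<sigma> u)) ` A"
  have J: "Inf J = inf_energy \<sigma> A" by (simp add: J_def inf_energy_def)
  have "J \<noteq> {}" using A(2) by (simp add: J_def)
  from Inf_as_limit[OF this] obtain f where f: "\<And>n. f n \<in> J" "f \<longlonglongrightarrow> Inf J" by blast
  have "\<forall>n. \<exists>u\<in>A. f n = ereal (energy \<sigma> u)" using f(1) by (auto simp: J_def)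
  then obtain u0 where u0A: "\<And>n. u0 n \<in> A" and fu0: "\<And>n. f n = ereal (energy \<sigma> (u0 n))" by metis
  define E where "E = energy \<sigma> (u0 0) + 1"
  have "Inf J \<le> ereal (energy \<sigma> (u0 0))" using f(1)[of 0] fu0 by (metis Inf_lower)
  also have "\<dots> < ereal E" by (simp add: E_def)
  finally have "\<forall>\<^sub>F n in sequentially. f n < ereal E" by (rule order_tendstoD(2)[OF f(2)])
  then obtain n0 where n0: "\<And>n. n \<ge> n0 \<Longrightarrow> energy \<sigma> (u0 n) < E"
    by (auto simp: eventually_sequentially fu0)
  define u where "u = (\<lambda>n. u0 (n + n0))"
  have uA: "u n \<in> A" for n by (simp add: u_def u0A)
  have uW: "u n \<in> W_plus" for n using uA A(1) by blast
  have uE: "energy \<sigma> (u n) \<le> E" for n using n0[of "n + n0"] by (simp add: u_def)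
  have ulim: "(\<lambda>n. ereal (energy \<sigma> (u n))) \<longlonglongrightarrow> Inf J"
    using LIMSEQ_ignore_initial_segment[OF f(2), of n0] by (simp add: u_def fu0)
  obtain K where K: "\<And>u. u \<in> W_plus \<Longrightarrow> mass u \<le> B \<Longrightarrow> energy \<sigma> u \<le> E \<Longrightarrow> (\<integral>x. norm (u x) ^ 4 \<partial>circ) \<le> K"
    by (rule energy_coercive[OF \<sigma>, of B E]) blast
  have u4: "(\<integral>x. norm (u n x) ^ 4 \<partial>circ) \<le> K" for n using K[OF uW B[OF uA] uE] .
  define C where "C = max K (4 * pi\<^sup>2 * (E + 2 * \<sigma> / pi * K))"
  have uG: "enn2real (gagliardo (u n)) \<le> C" for n
  proof -
    have "enn2real (gagliardo (u n)) = 4 * pi\<^sup>2 * (energy \<sigma> (u n) + 2 * \<sigma> / pi * (\<integral>x. norm (u n x) ^ 4 \<partial>circ))"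
      by (simp add: energy_circ)
    also have "\<dots> \<le> 4 * pi\<^sup>2 * (E + 2 * \<sigma> / pi * K)"
      using \<sigma> by (intro mult_left_mono add_mono uE u4) auto
    finally show ?thesis by (simp add: C_def)
  qed
  have "(\<integral>x. norm (u n x) ^ 4 \<partial>circ) \<le> C" for n using u4[of n] by (simp add: C_def)
  then obtain r :: "nat \<Rightarrow> nat" and v L where r: "strict_mono r" and v: "v \<in> W_plus"
    and L: "(\<lambda>n. enn2real (gagliardo (u (r n)))) \<longlonglongrightarrow> L" "enn2real (gagliardo v) \<le> L"
    and m4: "(\<lambda>n. \<integral>x. norm (u (r n) x) ^ 4 \<partial>circ) \<longlonglongrightarrow> (\<integral>x. norm (v x) ^ 4 \<partial>circ)"
    and m2: "(\<lambda>n. momentum (u (r n))) \<longlonglongrightarrow> momentum v"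
    and mm: "(\<lambda>n. mass (u (r n))) \<longlonglongrightarrow> mass v"
    by (rule W_plus_compact[of u C, OF uW _ uG]) blast
  have vA: "v \<in> A" by (rule closed[of "\<lambda>n. u (r n)", OF uA v mm m2])
  let ?e = "L / (4 * pi\<^sup>2) - 2 * \<sigma> / pi * (\<integral>x. norm (v x) ^ 4 \<partial>circ)"
  have "(\<lambda>n. energy \<sigma> (u (r n))) \<longlonglongrightarrow> ?e"
    unfolding energy_circ by (intro tendsto_intros L m4) auto
  then have "(\<lambda>n. ereal (energy \<sigma> (u (r n)))) \<longlonglongrightarrow> ereal ?e" by simp
  moreover have "(\<lambda>n. ereal (energy \<sigma> (u (r n)))) \<longlonglongrightarrow> Inf J"
    using LIMSEQ_subseq_LIMSEQ[OF ulim r] by (simp add: o_def)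
  ultimately have inf: "Inf J = ereal ?e" using LIMSEQ_unique by blast
  have "energy \<sigma> v \<le> ?e"
    unfolding energy_circ using L(2) by (intro diff_right_mono divide_right_mono) auto
  then have "ereal (energy \<sigma> v) \<le> Inf J" by (simp add: inf)
  moreover have "Inf J \<le> ereal (energy \<sigma> v)" using vA by (auto simp: J_def intro: Inf_lower)
  ultimately show ?thesis
    unfolding inf_energy_attained_def using vA J by (metis antisym)
qed

text \<open>On the first harmonic the numerator is the square of the denominator, up to the factor \<open>4\<close>.\<close>

lemma expi_W_plus: "expi 1 \<in> W_plus"
proof -
  have "gag_kernel (expi 1) x y \<le> 8" for x y
  proof -
    have "(norm (expi 1 x - expi 1 y))\<^sup>2 = 2 * (1 - cos (x - y))"
    proof -
      have "(norm (expi 1 x - expi 1 y))\<^sup>2 = (cos x - cos y)\<^sup>2 + (sin x - sin y)\<^sup>2"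
        unfolding cmod_power2 by (simp add: expi_def)
      also have "\<dots> = 2 * (1 - cos (x - y))"
        using sin_cos_squared_add[of x] sin_cos_squared_add[of y] unfolding cos_diff by algebra
      finally show ?thesis .
    qed
    moreover have "norm (expi 1 x - expi 1 y) ^ 4 = ((norm (expi 1 x - expi 1 y))\<^sup>2)\<^sup>2" by simp
    moreover have sq: "(2 * t)\<^sup>2 / t = 4 * t" for t :: real
      by (simp add: power2_eq_square)
    ultimately have "gag_kernel (expi 1) x y = 4 * (1 - cos (x - y))"
      unfolding gag_kernel_def by (simp only: sq)
    moreover have "4 * (1 - t) \<le> 8" if "- 1 \<le> t" for t :: real
      using that by simp
    ultimately show ?thesis by (simp only: cos_ge_minus_one)
  qed
  then have "gagliardo (expi 1) \<le> (\<integral>\<^sup>+x. \<integral>\<^sup>+y. ennreal 8 \<partial>circ \<partial>circ)"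
    unfolding gagliardo_circ by (intro nn_integral_mono ennreal_leI)
  also have "\<dots> < \<infinity>" by (simp add: ennreal_mult_less_top)
  finally show ?thesis
    using expi_Lp[of 1 4] by (simp add: W_plus_iff W_quarter_4_def fourier_coeff_expi)
qed

lemma exists_W_plus_momentum:
  assumes "P > 0"
  shows "\<exists>u\<in>W_plus. momentum u = P"
proof -
  have "momentum (\<lambda>x. of_real (sqrt (P / (2 * pi))) * expi 1 x) = P"
    using assms by (simp add: momentum_circ norm_mult)
  then show ?thesis using W_plus_cmult[OF expi_W_plus] by blast
qed

text \<open>By homogeneity only positivity of the mass of the first harmonic matters, not its value.\<close>

lemma exists_W_plus_mass:
  assumes "M > 0"
  shows "\<exists>u\<in>W_plus. mass u = M"
proof -
  have "mass (expi 1) \<noteq> 0"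
  proof
    assume "mass (expi 1) = 0"
    from mass_eq_0_imp_AE_zero[OF expi_W_plus this]
    have "(\<integral>x. norm (expi 1 x) \<partial>circ) = (\<integral>x. 0 \<partial>circ)"
      by (intro integral_cong_AE) (auto elim!: eventually_mono simp: expi_def)
    then show False by simp
  qed
  then have "mass (expi 1) > 0" using mass_nonneg[of "expi 1"] by simp
  then have "mass (\<lambda>x. of_real (sqrt (M / mass (expi 1))) * expi 1 x) = M"
    using assms by (simp add: mass_cmult[OF expi_Lp])
  then show ?thesis using W_plus_cmult[OF expi_W_plus] by blast
qed

theorem proposition5p3:
  fixes \<sigma> M P :: real
  assumes "\<sigma> \<in> {0, 1}" and "M > 0" and "P > 0"
  shows "({u \<in> W_plus. mass u = M \<and> momentum u = P} \<noteq> {} \<longrightarrow>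
           inf_energy_attained \<sigma> {u \<in> W_plus. mass u = M \<and> momentum u = P}) \<and>
         inf_energy_attained \<sigma> {u \<in> W_plus. momentum u = P} \<and>
         inf_energy_attained \<sigma> {u \<in> W_plus. mass u = M}"
proof -
  have \<sigma>: "\<sigma> \<ge> 0" using assms(1) by auto
  have const: "a = c" if "(\<lambda>n::nat. f n) \<longlonglongrightarrow> a" "\<And>n. f n = c" for f :: "nat \<Rightarrow> real" and a c
    using that LIMSEQ_unique[OF that(1), of c] by simp
  have mass_le: "mass u \<le> P" if "u \<in> W_plus" "momentum u = P" for u
    using mass_le_momentum[OF W_plusD(2)[OF that(1)]] that(2) by simp
  have "inf_energy_attained \<sigma> {u \<in> W_plus. mass u = M \<and> momentum u = P}"
    if "{u \<in> W_plus. mass u = M \<and> momentum u = P} \<noteq> {}"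
    using that by (intro inf_energy_attainedI[OF \<sigma>, where B=M]) (auto dest: const)
  moreover have "inf_energy_attained \<sigma> {u \<in> W_plus. momentum u = P}"
    using exists_W_plus_momentum[OF \<open>P > 0\<close>] mass_le
    by (intro inf_energy_attainedI[OF \<sigma>, where B=P]) (auto dest: const)
  moreover have "inf_energy_attained \<sigma> {u \<in> W_plus. mass u = M}"
    using exists_W_plus_mass[OF \<open>M > 0\<close>]
    by (intro inf_energy_attainedI[OF \<sigma>, where B=M]) (auto dest: const)
  ultimately show ?thesis by blast
qed

end
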